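(* Let $n\ge 1$ and let $f\in S_n=\mathbb C[x_1,x_1^{-1},\dots,x_n,x_n^{-1}]$ be a Laurent polynomial with vanishing logarithmic Hessian, i.e. $\det\left((x_i f_{x_i})_{x_j}\right)_{1\le i,j\le n}=0$ in $S_n$. Let $\mathcal F_f$ be the foliation on $(\mathbb C^* )^n$ determined by the fibers of the logarithmic polar map $L_f:(\mathbb C^* )^n\to\mathbb C^n$, $L_f(x)=(x_1f_{x_1}(x),\dots,x_nf_{x_n}(x))$. Then the logarithmic Gauss map $\mathcal G(\mathcal F_f)$ of $\mathcal F_f$ is constant.
   Context: Subscripts $x_i$ on functions denote partial derivatives. Foliations: a singular holomorphic foliation $\mathcal F$ of dimension $k$ ($1\le k<\dim M$) on a complex variety $M$ of dimension $n$ is given by a line bundle $\mathcal L$ and a section $\omega\in \mathrm H^0(M,\Omega_M^{n-k}\otimes\mathcal L)$ whose zero set $\mathrm{Sing}(\omega)$ (the singular set of $\mathcal F$) has codimension at least $2$ and which is integrable: every $x\in M\setminus\mathrm{Sing}(\omega)$ has a neighborhood $V$ with 1-forms $\alpha_1,\dots,\alpha_{n-k}$ such that $\omega|_V=\alpha_1\wedge\cdots\wedge\alpha_{n-k}$ and $d\alpha_i\wedge\omega|_V=0$ for all $i$. At each regular point $x$ (i.e. $x\notin\mathrm{Sing}(\omega)$) the kernel of $\omega$ is a $k$-dimensional subspace $T_x\mathcal F\subset T_xM$, the tangent space of the leaf through $x$. Logarithmic Gauss map: let $G=(\mathbb C^* )^n$ with Lie algebra $\mathfrak g\cong\mathbb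 C^n$, let $l_x:G\to G$, $l_x(\tilde x)=x\tilde x$ be translation, and let $\mathrm G(k,\mathfrak g)$ be the Grassmannian of $k$-dimensional linear subspaces of $\mathfrak g$. For a foliation $\mathcal F$ of dimension $k$ on $G$, the logarithmic Gauss map is the rational map $\mathcal G(\mathcal F):G\dashrightarrow \mathrm G(k,\mathfrak g)$, $x\mapsto d(l_{x^{-1}})(x)(T_x\mathcal F)$, defined at the regular points of $\mathcal F$. The foliation $\mathcal F_f$: let $n-k$ be the (generic, i.e. maximal) rank of the differential of $L_f$; vanishing logarithmic Hessian means $1\le k\le n$. If $1\le k\le n-1$, $\mathcal F_f$ is the singular holomorphic foliation of dimension $k$ on $(\mathbb C^* )^n$ such that $L_f$ is constant on each leaf; thus $T_x\mathcal F_f=\ker dL_f(x)$ at every point $x$ where $dL_f(x)$ has maximal rank $n-k$. If $k=n$ (so $L_f$ is constant), $\mathcal G(\mathcal F_f)$ denotes by convention the constant map sending every $x$ to $\mathfrak g$. *)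

theory Defs
  imports
    "HOL-Analysis.Analysis"
    "HOL-Combinatorics.Permutations"
    "HOL-Library.Poly_Mapping"
begin

section \<open>Laurent polynomials\<close>

text \<open>
  The group algebra of the lattice \<open>int^'n\<close>: an exponent vector \<open>m\<close> carries the coefficient of
  \<open>x^m\<close>, and the product on \<^type>\<open>poly_mapping\<close> is convolution, so this is the ring
  \<open>\<complex>[x_1, x_1^-1, ..., x_n, x_n^-1]\<close> with \<open>n = CARD('n)\<close>.
\<close>

type_synonym 'n laurent = "(int ^ 'n) \<Rightarrow>\<^sub>0 complex"

definition lvar :: "'n::finite \<Rightarrow> 'n laurent" where
  "lvar i = Poly_Mapping.single (axis i 1) 1"

definition lpderiv :: "'n::finite \<Rightarrow> 'n laurent \<Rightarrow> 'n laurent" where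
  "lpderiv j f = (\<Sum>m\<in>Poly_Mapping.keys f.
     Poly_Mapping.single (m - axis j 1) (of_int (m $ j) * Poly_Mapping.lookup f m))"

definition leval :: "'n::finite laurent \<Rightarrow> complex ^ 'n \<Rightarrow> complex" where
  "leval f x = (\<Sum>m\<in>Poly_Mapping.keys f. Poly_Mapping.lookup f m * (\<Prod>i\<in>UNIV. x $ i powi (m $ i)))"

definition log_hessian :: "'n::finite laurent \<Rightarrow> 'n laurent ^ 'n ^ 'n" where
  "log_hessian f = (\<chi> i j. lpderiv j (lvar i * lpderiv i f))"

section \<open>The torus and the logarithmic polar map\<close>

definition torus :: "(complex ^ 'n::finite) set" where
  "torus = {x. \<forall>i. x $ i \<noteq> 0}"

text \<open>Multiplication on \<^type>\<open>vec\<close> is componentwise, hence the group law of the torus.\<close>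

definition torus_inverse :: "complex ^ 'n::finite \<Rightarrow> complex ^ 'n" where
  "torus_inverse x = (\<chi> i. inverse (x $ i))"

definition translation :: "complex ^ 'n::finite \<Rightarrow> complex ^ 'n \<Rightarrow> complex ^ 'n" where
  "translation x y = x * y"

definition log_polar :: "'n::finite laurent \<Rightarrow> complex ^ 'n \<Rightarrow> complex ^ 'n" where
  "log_polar f x = (\<chi> i. x $ i * leval (lpderiv i f) x)"

definition polar_rank_at :: "'n::finite laurent \<Rightarrow> complex ^ 'n \<Rightarrow> nat" where
  "polar_rank_at f x = vec.dim (range (frechet_derivative (log_polar f) (at x)))"

definition generic_polar_rank :: "'n::finite laurent \<Rightarrow> nat" where
  "generic_polar_rank f = Max (polar_rank_at f ` torus)"

definition polar_fiber_dim :: "'n::finite laurent \<Rightarrow> nat" where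
  "polar_fiber_dim f = CARD('n) - generic_polar_rank f"

section \<open>Holomorphic functions and forms in several variables\<close>

definition holomorphic_fun :: "(complex ^ 'n::finite) set \<Rightarrow> (complex ^ 'n \<Rightarrow> complex) \<Rightarrow> bool" where
  "holomorphic_fun U g \<longleftrightarrow> open U \<and>
     (\<forall>x\<in>U. \<exists>D. (g has_derivative D) (at x) \<and> Vector_Spaces.linear (*s) (*) D)"

definition holomorphic_map :: "(complex ^ 'n::finite) set \<Rightarrow> (complex ^ 'n \<Rightarrow> complex ^ 'n) \<Rightarrow> bool" where
  "holomorphic_map U \<Phi> \<longleftrightarrow> (\<forall>i. holomorphic_fun U (\<lambda>x. \<Phi> x $ i))"

text \<open>
  The tangent space at any point of an open subset of \<open>\<complex>^n\<close> is \<open>\<complex>^n\<close>.  An exterior \<open>q\<close>-form at a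
  point is an alternating multilinear function of the vectors \<open>v 0, ..., v (q - 1)\<close>; arguments
  with index \<open>\<ge> q\<close> are ignored, which the first clause expresses.
\<close>

type_synonym 'n ext_form = "(nat \<Rightarrow> complex ^ 'n) \<Rightarrow> complex"

definition alternating_form :: "nat \<Rightarrow> 'n::finite ext_form \<Rightarrow> bool" where
  "alternating_form q \<phi> \<longleftrightarrow>
     (\<forall>v w. (\<forall>i<q. v i = w i) \<longrightarrow> \<phi> v = \<phi> w) \<and>
     (\<forall>v. \<forall>i<q. Vector_Spaces.linear (*s) (*) (\<lambda>u. \<phi> (v(i := u)))) \<and>
     (\<forall>v. \<forall>i<q. \<forall>j<q. i \<noteq> j \<longrightarrow> v i = v j \<longrightarrow> \<phi> v = 0)"

definition holomorphic_form ::
    "nat \<Rightarrow> (complex ^ 'n::finite) set \<Rightarrow> (complex ^ 'n \<Rightarrow> 'n ext_form) \<Rightarrow> bool" where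
  "holomorphic_form q U \<omega> \<longleftrightarrow>
     (\<forall>x\<in>U. alternating_form q (\<omega> x)) \<and> (\<forall>v. holomorphic_fun U (\<lambda>x. \<omega> x v))"

text \<open>One-forms are given directly as fields of linear functionals.\<close>

definition holomorphic_one_form ::
    "(complex ^ 'n::finite) set \<Rightarrow> (complex ^ 'n \<Rightarrow> complex ^ 'n \<Rightarrow> complex) \<Rightarrow> bool" where
  "holomorphic_one_form U \<alpha> \<longleftrightarrow>
     (\<forall>x\<in>U. Vector_Spaces.linear (*s) (*) (\<alpha> x)) \<and> (\<forall>v. holomorphic_fun U (\<lambda>x. \<alpha> x v))"

text \<open>\<open>\<alpha>_0 \<and> ... \<and> \<alpha>_(q-1)\<close>, evaluated on \<open>v\<close>, is the determinant of the matrix \<open>\<alpha>_i (v_j)\<close>.\<close>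

definition wedge_one_forms :: "nat \<Rightarrow> (nat \<Rightarrow> complex ^ 'n::finite \<Rightarrow> complex) \<Rightarrow> 'n ext_form" where
  "wedge_one_forms q \<alpha> v =
     (\<Sum>\<sigma> | \<sigma> permutes {..<q}. of_int (sign \<sigma>) * (\<Prod>i<q. \<alpha> i (v (\<sigma> i))))"

definition ext_deriv_one_form ::
    "(complex ^ 'n::finite \<Rightarrow> complex ^ 'n \<Rightarrow> complex) \<Rightarrow> complex ^ 'n \<Rightarrow>
     complex ^ 'n \<Rightarrow> complex ^ 'n \<Rightarrow> complex" where
  "ext_deriv_one_form \<alpha> x u v =
     frechet_derivative (\<lambda>y. \<alpha> y v) (at x) u - frechet_derivative (\<lambda>y. \<alpha> y u) (at x) v"

definition wedge_two_form ::
    "nat \<Rightarrow> (complex ^ 'n::finite \<Rightarrow> complex ^ 'n \<Rightarrow> complex) \<Rightarrow> 'n ext_form \<Rightarrow> 'n ext_form" where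
  "wedge_two_form q \<beta> \<phi> v =
     (\<Sum>\<sigma> | \<sigma> permutes {..<q + 2}.
        of_int (sign \<sigma>) * \<beta> (v (\<sigma> 0)) (v (\<sigma> 1)) * \<phi> (\<lambda>j. v (\<sigma> (j + 2)))) / (2 * fact q)"

text \<open>
  The dimension of an analytic set is the largest dimension of a regular point, that is, of a
  point near which the set is a complex submanifold.
\<close>

definition submanifold_at :: "nat \<Rightarrow> (complex ^ 'n::finite) set \<Rightarrow> complex ^ 'n \<Rightarrow> bool" where
  "submanifold_at d A p \<longleftrightarrow>
     (\<exists>U V \<Phi> \<Psi> I. p \<in> U \<and> holomorphic_map U \<Phi> \<and> holomorphic_map V \<Psi> \<and>
        \<Phi> ` U = V \<and> (\<forall>x\<in>U. \<Psi> (\<Phi> x) = x) \<and> card (I :: 'n set) = d \<and>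
        \<Phi> ` (A \<inter> U) = {z \<in> V. \<forall>i. i \<notin> I \<longrightarrow> z $ i = 0})"

definition analytic_codim_ge :: "nat \<Rightarrow> (complex ^ 'n::finite) set \<Rightarrow> bool" where
  "analytic_codim_ge c A \<longleftrightarrow> (\<forall>p\<in>A. \<forall>d. submanifold_at d A p \<longrightarrow> d + c \<le> CARD('n))"

section \<open>Singular holomorphic foliations\<close>

text \<open>
  A section of \<open>\<Omega>^q \<otimes> L\<close> over an open subset of \<open>\<complex>^n\<close>: the line bundle \<open>L\<close> is given by a cocycle with
  respect to an open cover that trivialises it, and the section by its local \<open>q\<close>-forms.
\<close>

record ('i, 'n) twisted_form =
  tf_chart :: "'i \<Rightarrow> (complex ^ 'n) set"
  tf_cocycle :: "'i \<Rightarrow> 'i \<Rightarrow> complex ^ 'n \<Rightarrow> complex"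
  tf_form :: "'i \<Rightarrow> complex ^ 'n \<Rightarrow> 'n ext_form"

definition line_bundle_on :: "(complex ^ 'n::finite) set \<Rightarrow> ('i, 'n) twisted_form \<Rightarrow> bool" where
  "line_bundle_on M F \<longleftrightarrow>
     (\<forall>a. open (tf_chart F a)) \<and> (\<Union>a. tf_chart F a) = M \<and>
     (\<forall>a b. holomorphic_fun (tf_chart F a \<inter> tf_chart F b) (tf_cocycle F a b)) \<and>
     (\<forall>a b. \<forall>x\<in>tf_chart F a \<inter> tf_chart F b. tf_cocycle F a b x \<noteq> 0) \<and>
     (\<forall>a b c. \<forall>x\<in>tf_chart F a \<inter> tf_chart F b \<inter> tf_chart F c.
        tf_cocycle F a b x * tf_cocycle F b c x = tf_cocycle F a c x)"

definition twisted_form_on ::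
    "nat \<Rightarrow> (complex ^ 'n::finite) set \<Rightarrow> ('i, 'n) twisted_form \<Rightarrow> bool" where
  "twisted_form_on q M F \<longleftrightarrow> line_bundle_on M F \<and>
     (\<forall>a. holomorphic_form q (tf_chart F a) (tf_form F a)) \<and>
     (\<forall>a b. \<forall>x\<in>tf_chart F a \<inter> tf_chart F b. \<forall>v.
        tf_form F a x v = tf_cocycle F a b x * tf_form F b x v)"

definition sing_set :: "('i, 'n::finite) twisted_form \<Rightarrow> (complex ^ 'n) set" where
  "sing_set F = {x. \<exists>a. x \<in> tf_chart F a \<and> (\<forall>v. tf_form F a x v = 0)}"

definition integrable_form :: "nat \<Rightarrow> ('i, 'n::finite) twisted_form \<Rightarrow> bool" where
  "integrable_form q F \<longleftrightarrow>
     (\<forall>a. \<forall>x\<in>tf_chart F a - sing_set F. \<exists>V \<alpha>.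
        open V \<and> x \<in> V \<and> V \<subseteq> tf_chart F a \<and>
        (\<forall>i<q. holomorphic_one_form V (\<alpha> i)) \<and>
        (\<forall>y\<in>V. tf_form F a y = wedge_one_forms q (\<lambda>i. \<alpha> i y)) \<and>
        (\<forall>i<q. \<forall>y\<in>V. \<forall>v.
           wedge_two_form q (ext_deriv_one_form (\<alpha> i) y) (tf_form F a y) v = 0))"

definition foliation_on ::
    "nat \<Rightarrow> (complex ^ 'n::finite) set \<Rightarrow> ('i, 'n) twisted_form \<Rightarrow> bool" where
  "foliation_on k M F \<longleftrightarrow> 1 \<le> k \<and> k < CARD('n) \<and>
     twisted_form_on (CARD('n) - k) M F \<and>
     analytic_codim_ge 2 (sing_set F) \<and>
     integrable_form (CARD('n) - k) F"

definition regular_points :: "('i, 'n::finite) twisted_form \<Rightarrow> (complex ^ 'n) set" where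
  "regular_points F = (\<Union>a. tf_chart F a) - sing_set F"

text \<open>
  The kernel of \<open>\<omega>\<close> at \<open>x\<close> consists of the vectors whose contraction with \<open>\<omega>\<close> vanishes; the choice of
  chart does not matter, since the local forms differ by a nonzero factor.
\<close>

definition tangent_space ::
    "('i, 'n::finite) twisted_form \<Rightarrow> complex ^ 'n \<Rightarrow> (complex ^ 'n) set" where
  "tangent_space F x =
     {u. \<forall>a. x \<in> tf_chart F a \<longrightarrow> (\<forall>v. tf_form F a x (v(0 := u)) = 0)}"

text \<open>
  The leaf through \<open>x\<close>: all points that can be joined to \<open>x\<close> by a piecewise continuously
  differentiable path of regular points that is tangent to the foliation.
\<close>

definition leaf :: "('i, 'n::finite) twisted_form \<Rightarrow> complex ^ 'n \<Rightarrow> (complex ^ 'n) set" where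
  "leaf F x = {y. \<exists>\<gamma>. valid_path \<gamma> \<and> pathstart \<gamma> = x \<and> pathfinish \<gamma> = y \<and>
     path_image \<gamma> \<subseteq> regular_points F \<and>
     (\<exists>S. finite S \<and> (\<forall>t\<in>{0..1} - S.
        \<exists>u\<in>tangent_space F (\<gamma> t). (\<gamma> has_vector_derivative u) (at t)))}"

section \<open>The logarithmic Gauss map\<close>

definition grassmannian :: "nat \<Rightarrow> (complex ^ 'n::finite) set set" where
  "grassmannian k = {W. vec.subspace W \<and> vec.dim W = k}"

definition log_gauss_map ::
    "('i, 'n::finite) twisted_form \<Rightarrow> complex ^ 'n \<Rightarrow> (complex ^ 'n) set" where
  "log_gauss_map F x =
     frechet_derivative (translation (torus_inverse x)) (at x) ` tangent_space F x"

text \<open>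
  \<open>F\<close> represents the foliation determined by the fibers of the logarithmic polar map of \<open>f\<close>.
  There is such an \<open>F\<close> only if the generic rank is positive.
\<close>

definition is_polar_foliation :: "'n::finite laurent \<Rightarrow> ('i, 'n) twisted_form \<Rightarrow> bool" where
  "is_polar_foliation f F \<longleftrightarrow> foliation_on (polar_fiber_dim f) torus F \<and>
     (\<forall>x\<in>regular_points F. log_polar f constant_on leaf F x)"

text \<open>
  If the logarithmic polar map is constant there is no foliation: \<open>F\<close> is ignored and, by convention,
  the logarithmic Gauss map sends every point of the torus to the whole Lie algebra.
\<close>

definition polar_gauss_domain ::
    "'n::finite laurent \<Rightarrow> ('i, 'n) twisted_form \<Rightarrow> (complex ^ 'n) set" where
  "polar_gauss_domain f F = (if polar_fiber_dim f = CARD('n) then torus else regular_points F)"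

definition polar_gauss_map ::
    "'n::finite laurent \<Rightarrow> ('i, 'n) twisted_form \<Rightarrow> complex ^ 'n \<Rightarrow> (complex ^ 'n) set" where
  "polar_gauss_map f F x = (if polar_fiber_dim f = CARD('n) then UNIV else log_gauss_map F x)"

end

theory Submission
  imports Defs "HOL-Complex_Analysis.Conformal_Mappings"
begin

text \<open>
  In logarithmic coordinates the derivative of the polar map at \<open>x\<close> is the matrix
  \<open>\<Sum> a\<^sub>m x\<^sup>m m m\<^sup>T\<close>, whose kernel contains the annihilator \<open>W\<close> of all exponents \<open>m\<close> of \<open>f\<close>.
  Along a generic one-parameter subgroup the exponents get distinct weights, and in a basis of
  exponents chosen greedily by weight the matrix is asymptotically diagonal; so the kernel equals
  \<open>W\<close> on a dense subset of the torus, and \<open>W\<close> has the dimension of the foliation. A tangent vector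
  of the foliation extends to a local tangent field; the polar map is constant along its integral
  curve, so the vector lies in the kernel of the derivative. Hence the translate of the tangent
  space is \<open>W\<close> at generic points, and by continuity and dimension at every regular point.
\<close>

section \<open>Exponential sums of rank one matrices\<close>

text \<open>The coefficients \<open>a_m x^m\<close> are complex, so a sum of rank one matrices can
  lose rank by cancellation, and no positivity argument rules this out. Distinct real weights do:
  far out on the subgroup one exponential dominates each diagonal entry, and nothing is left to
  cancel it. That alone gives a good point far away from \<open>x\<close>. Since the determinant is
  an entire function of the parameter, it cannot vanish on a neighborhood of 0, and so good points
  exist arbitrarily close to \<open>x\<close>. Density is what is needed, because a regular point of
  the foliation may be a point where the rank of the derivative drops. There the kernel is larger
  than \<open>W\<close> and does not determine the tangent space, which has to be recovered from
  nearby points.\<close>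

lemma norm_vector_smult: "norm (c *s x) = norm c * norm x" for c :: complex and x :: "complex ^ 'n::finite"
  unfolding norm_vec_def L2_set_def
  by (simp add: norm_mult power_mult_distrib flip: sum_distrib_left)
     (simp add: real_sqrt_mult)

lemma bounded_linear_vector_smult: "bounded_linear (\<lambda>c. c *s x)" for x :: "complex ^ 'n::finite"
  by (rule bounded_linear_intro[where K = "norm x"])
     (auto simp: vec_eq_iff algebra_simps norm_vector_smult scaleR_conv_of_real[where 'a = complex])

definition pairing :: "complex ^ 'n::finite \<Rightarrow> complex ^ 'n \<Rightarrow> complex" where
  "pairing m u = (\<Sum>i\<in>UNIV. m $ i * u $ i)"

lemma pairing_sum_left: "pairing (\<Sum>i\<in>A. c i *s v i) u = (\<Sum>i\<in>A. c i * pairing (v i) u)"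
  unfolding pairing_def
  by (simp add: sum_distrib_left sum_distrib_right mult.assoc) (rule sum.swap)

text \<open>The greedy algorithm of matroid theory: elements are offered from the heaviest to the
  lightest and kept if independent of those kept before. A rejected element depends on kept ones
  that are at least as heavy.\<close>

lemma greedy_basis:
  fixes E :: "(complex ^ 'n::finite) set" and l :: "complex ^ 'n \<Rightarrow> real"
  assumes "finite E"
  shows "\<exists>G\<subseteq>E. vec.independent G \<and> (\<forall>m\<in>E. m \<in> vec.span {g\<in>G. l m \<le> l g})"
  using assms
\<comment> \<open>Ranking by \<open>- l\<close> makes the newly inserted \<open>x\<close> the
  lightest element, so its own span condition refers to all of \<open>G\<close>.\<close>
proof (induction E rule: finite_ranking_induct[where f = "\<lambda>m. - l m"])
  case empty
  show ?case by (intro exI[of _ "{}"]) (simp add: vec.independent_empty)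
next
  case (insert x S)
  then obtain G where G: "G \<subseteq> S" "vec.independent G" "\<forall>m\<in>S. m \<in> vec.span {g\<in>G. l m \<le> l g}"
    by blast
  have le: "l x \<le> l g" if "g \<in> G" for g using insert(2)[of g] G(1) that by auto
  show ?case
  proof (cases "x \<in> vec.span G")
    case True
    moreover have "{g\<in>G. l x \<le> l g} = G" using le by auto
    ultimately show ?thesis using G by (intro exI[of _ G]) auto
  next
    case False
    have "m \<in> vec.span {g\<in>insert x G. l m \<le> l g}" if "m \<in> insert x S" for m
    proof (cases "m = x")
      case True
      then show ?thesis by (auto intro: vec.span_base)
    next
      case False
      have "{g\<in>G. l m \<le> l g} \<subseteq> {g\<in>insert x G. l m \<le> l g}" by auto
      then show ?thesis using G(3) False that vec.span_mono by blast
    qed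
    moreover have "vec.independent (insert x G)" using G(2) False vec.independent_insertI by blast
    ultimately show ?thesis using G(1) by (intro exI[of _ "insert x G"]) auto
  qed
qed

text \<open>Congruence by a diagonal matrix: each permutation meets every row and every column once.
  It allows the determinant to be tested for zero after rescaling.\<close>

lemma det_scale_rows_columns:
  fixes A :: "complex ^ 'n::finite ^ 'n"
  shows "det (\<chi> i j. e i * e j * A $ i $ j) = (\<Prod>i\<in>UNIV. e i)\<^sup>2 * det A"
proof -
  have "(\<Prod>i\<in>UNIV. e i * e (p i) * A $ i $ p i) = (\<Prod>i\<in>UNIV. e i)\<^sup>2 * (\<Prod>i\<in>UNIV. A $ i $ p i)"
    if "p permutes UNIV" for p :: "'n \<Rightarrow> 'n"
    using prod.permute[OF that, of e]
    by (simp add: prod.distrib power2_eq_square comp_def)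
  then show ?thesis
    unfolding det_def sum_distrib_left by (intro sum.cong) auto
qed

lemma tendsto_det:
  fixes A :: "'a \<Rightarrow> complex ^ 'n::finite ^ 'n"
  assumes "\<And>i j. ((\<lambda>s. A s $ i $ j) \<longlongrightarrow> L $ i $ j) F"
  shows "((\<lambda>s. det (A s)) \<longlongrightarrow> det L) F"
  unfolding det_def by (intro tendsto_intros assms)

text \<open>
  The Hessian \<open>\<Sum> a\<^sub>m e\<^bsup>l(m) s\<^esup> m m\<^sup>T\<close> is written in a basis extending a subset \<open>G\<close> of \<open>E\<close> that is
  chosen greedily in order of decreasing \<open>l\<close>, so that its diagonal dominates, after scaling rows
  and columns, as \<open>s\<close> tends to infinity.
\<close>

lemma exponential_sum_kernel:
  fixes E :: "(complex ^ 'n::finite) set" and l :: "complex ^ 'n \<Rightarrow> real"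
    and a :: "complex ^ 'n \<Rightarrow> complex"
  assumes fin: "finite E" and a: "\<And>m. m \<in> E \<Longrightarrow> a m \<noteq> 0" and inj: "inj_on l E"
  obtains D where "D holomorphic_on UNIV" "\<exists>s. D s \<noteq> 0"
    "\<forall>s u. D s \<noteq> 0 \<longrightarrow> (\<Sum>m\<in>E. (a m * exp (of_real (l m) * s) * pairing m u) *s m) = 0 \<longrightarrow>
       (\<forall>m\<in>E. pairing m u = 0)"
proof -
  obtain G where G: "G \<subseteq> E" "vec.independent G" "\<And>m. m \<in> E \<Longrightarrow> m \<in> vec.span {g\<in>G. l m \<le> l g}"
    using greedy_basis[OF fin] by metis
  define B where "B = vec.extend_basis G"
  have B: "G \<subseteq> B" "vec.independent B" "vec.span B = UNIV"
    using vec.extend_basis_superset[OF G(2)] vec.independent_extend_basis[OF G(2)]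
      vec.span_extend_basis[OF G(2)] by (auto simp: B_def)
  have finB: "finite B" using B(2) by (rule vec.finiteI_independent)
  have "card B = CARD('n)"
    using vec.dim_eq_card_independent[OF B(2)] vec.dim_span[of B] B(3) vec_dim_card by metis
  then obtain \<psi> where \<psi>: "bij_betw \<psi> (UNIV :: 'n set) B"
    using finite_same_card_bij[of "UNIV :: 'n set" B] finB by auto
  define \<mu> where "\<mu> i m = vec.representation B m (\<psi> i)" for i m
  have sumB: "(\<Sum>i\<in>UNIV. \<mu> i m *s \<psi> i) = m" for m
    using vec.sum_representation_eq[OF B(2) _ finB subset_refl, of m] B(3)
      sum.reindex_bij_betw[OF \<psi>, of "\<lambda>b. vec.representation B m b *s b"]
    unfolding \<mu>_def by simp
  \<comment> \<open>Coordinates are unique, so those of \<open>m\<close> in \<open>B\<close> are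
    those in the heavy part of \<open>G\<close> whose span contains \<open>m\<close>; all others
    vanish.\<close>
  have \<mu>nz: "\<psi> i \<in> G \<and> l m \<le> l (\<psi> i)" if "m \<in> E" "\<mu> i m \<noteq> 0" for i m
  proof -
    have "vec.representation B m = vec.representation {g\<in>G. l m \<le> l g} m"
      using B(1) by (intro vec.representation_extend B(2) G(3) that(1)) auto
    then show ?thesis
      using that(2) vec.representation_ne_zero[of "{g\<in>G. l m \<le> l g}" m "\<psi> i"] by (auto simp: \<mu>_def)
  qed
  have \<psi>B: "\<psi> i \<in> B" for i using \<psi> by (auto simp: bij_betw_def)
  have \<psi>inj: "\<psi> i = \<psi> j \<longleftrightarrow> i = j" for i j using \<psi> by (auto simp: bij_betw_def inj_on_def)
  have \<mu>\<psi>: "\<mu> i (\<psi> j) = (if i = j then 1 else 0)" for i j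
    using vec.representation_basis[OF B(2) \<psi>B[of j]] \<psi>inj[of j i] by (auto simp: \<mu>_def)
  have \<mu>sum: "\<mu> i (\<Sum>m\<in>E. c m *s m) = (\<Sum>m\<in>E. c m * \<mu> i m)" for i c
    using B by (simp add: \<mu>_def vec.representation_sum vec.representation_scale)
  \<comment> \<open>The Hessian as a bilinear form in the coordinates \<open>\<mu>\<close>.
    Coordinates outside \<open>G\<close> vanish on \<open>E\<close>, so their rows and columns would
    be zero when \<open>E\<close> does not span. The 1 added on the diagonal there makes the
    determinant that of the block of \<open>G\<close>.\<close>
  define M :: "complex \<Rightarrow> complex ^ 'n ^ 'n" where
    "M s = (\<chi> i j. (\<Sum>m\<in>E. a m * exp (of_real (l m) * s) * \<mu> i m * \<mu> j m) +
              (if i = j \<and> \<psi> i \<notin> G then 1 else 0))" for s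
  show thesis
  proof (rule that[of "\<lambda>s. det (M s)"])
    show "(\<lambda>s. det (M s)) holomorphic_on UNIV"
      unfolding det_def M_def by (simp, intro holomorphic_intros)
  next
    \<comment> \<open>Rows and columns are each damped by half the weight of their basis vector, so
      entry \<open>(i, j)\<close> is damped by the mean of two weights and diagonal entry
      \<open>i\<close> by the full weight of \<open>\<psi> i\<close>. The weight 0 outside
      \<open>G\<close> leaves the padding 1 unchanged.\<close>
    define p where "p i = (if \<psi> i \<in> G then l (\<psi> i) else 0)" for i
    define e where "e s i = (exp (- (p i * s / 2)) :: complex)" for s :: real and i
    define L :: "complex ^ 'n ^ 'n" where
      "L = (\<chi> i j. if i = j then if \<psi> i \<in> G then a (\<psi> i) else 1 else 0)"
    have "((\<lambda>s. det (\<chi> i j. e s i * e s j * M (of_real s) $ i $ j)) \<longlongrightarrow> det L) at_top"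
    proof (rule tendsto_det)
      fix i j
      have summand: "((\<lambda>s. e s i * e s j * (a m * exp (of_real (l m) * of_real s) * \<mu> i m * \<mu> j m)) \<longlongrightarrow>
          (if m = \<psi> i \<and> m = \<psi> j \<and> m \<in> G then a m else 0)) at_top" if m: "m \<in> E" for m
      proof (cases "\<mu> i m = 0 \<or> \<mu> j m = 0")
        case True
        then have "\<not> (m = \<psi> i \<and> m = \<psi> j)" using \<mu>\<psi> \<psi>inj by auto
        then show ?thesis using True by auto
      next
        case False
        then have ij: "\<psi> i \<in> G" "l m \<le> l (\<psi> i)" "\<psi> j \<in> G" "l m \<le> l (\<psi> j)"
          using \<mu>nz m by auto
        \<comment> \<open>The net decay rate of the contribution of \<open>m\<close>. It is
          nonnegative by the choice of \<open>G\<close>, and zero only if \<open>m\<close>,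
          \<open>\<psi> i\<close> and \<open>\<psi> j\<close> have equal weight, hence coincide by
          \<open>inj\<close>.\<close>
        define d where "d = (l (\<psi> i) + l (\<psi> j)) / 2 - l m"
        have ex: "e s i * e s j * exp (of_real (l m) * of_real s) = of_real (exp (- d * s))" for s
        proof -
          have "- (p i * s / 2) + - (p j * s / 2) + l m * s = - d * s"
            using ij by (simp add: p_def d_def field_simps)
          then have "exp (- (p i * s / 2)) * exp (- (p j * s / 2)) * exp (l m * s) = exp (- d * s)"
            by (simp only: mult_exp_exp)
          then show ?thesis unfolding e_def by (metis exp_of_real of_real_mult)
        qed
        have eq: "e s i * e s j * (a m * exp (of_real (l m) * of_real s) * \<mu> i m * \<mu> j m) =
            of_real (exp (- d * s)) * (a m * \<mu> i m * \<mu> j m)" for s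
          unfolding ex [symmetric] by (simp add: mult_ac)
        show ?thesis
        proof (cases "d = 0")
          case True
          then have "l m = l (\<psi> i)" "l m = l (\<psi> j)" using ij by (auto simp: d_def)
          then have "m = \<psi> i" "m = \<psi> j"
            using inj_onD[OF inj _ m, of "\<psi> i"] inj_onD[OF inj _ m, of "\<psi> j"] ij(1,3) G(1) by auto
          then show ?thesis unfolding eq using True ij \<mu>\<psi>[of i i] \<mu>\<psi>[of j j] by auto
        next
          case False
          then have "d > 0" using ij by (auto simp: d_def)
          then have "((\<lambda>s. exp (- d * s)) \<longlongrightarrow> 0) at_top"
            by (intro filterlim_compose[OF exp_at_bot] filterlim_tendsto_neg_mult_at_bot[OF tendsto_const _ filterlim_ident]) auto
          then have "((\<lambda>s. complex_of_real (exp (- d * s)) * (a m * \<mu> i m * \<mu> j m)) \<longlongrightarrow>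
              of_real 0 * (a m * \<mu> i m * \<mu> j m)) at_top"
            by (intro tendsto_intros)
          moreover have "\<not> (m = \<psi> i \<and> m = \<psi> j)" using False by (auto simp: d_def)
          ultimately show ?thesis unfolding eq by auto
        qed
      qed
      have diag: "((\<lambda>s. e s i * e s j * (if i = j \<and> \<psi> i \<notin> G then 1 else 0)) \<longlongrightarrow>
          (if i = j \<and> \<psi> i \<notin> G then 1 else 0)) at_top"
        by (auto simp: e_def p_def)
      have "(\<Sum>m\<in>E. if m = \<psi> i \<and> m = \<psi> j \<and> m \<in> G then a m else 0) =
          (if i = j \<and> \<psi> i \<in> G then a (\<psi> i) else 0)"
      proof (cases "i = j \<and> \<psi> i \<in> G")
        case True
        then have "(\<Sum>m\<in>E. if m = \<psi> i \<and> m = \<psi> j \<and> m \<in> G then a m else 0) =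
           (\<Sum>m\<in>E. if m = \<psi> i then a m else 0)" by (intro sum.cong) auto
        then show ?thesis using True G(1) fin by auto
      qed (auto simp: \<psi>inj intro!: sum.neutral)
      then have "L $ i $ j = (\<Sum>m\<in>E. if m = \<psi> i \<and> m = \<psi> j \<and> m \<in> G then a m else 0) +
          (if i = j \<and> \<psi> i \<notin> G then 1 else 0)"
        by (auto simp: L_def)
      moreover have "(\<chi> i j. e s i * e s j * M s $ i $ j) $ i $ j =
          (\<Sum>m\<in>E. e s i * e s j * (a m * exp (of_real (l m) * of_real s) * \<mu> i m * \<mu> j m)) +
          e s i * e s j * (if i = j \<and> \<psi> i \<notin> G then 1 else 0)" for s
        by (simp add: M_def sum_distrib_left ring_distribs)
      ultimately show "((\<lambda>s. (\<chi> i j. e s i * e s j * M s $ i $ j) $ i $ j) \<longlongrightarrow> L $ i $ j) at_top"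
        by (simp only:) (intro tendsto_add tendsto_sum summand diag)
    qed
    moreover have "det L = (\<Prod>i\<in>UNIV. L $ i $ i)" by (rule det_diagonal) (auto simp: L_def)
    then have "det L \<noteq> 0" using a G(1) by (auto simp: L_def)
    ultimately have "eventually (\<lambda>s. det (\<chi> i j. e s i * e s j * M (of_real s) $ i $ j) \<noteq> 0) at_top"
      by (rule tendsto_imp_eventually_ne)
    then obtain s where "det (\<chi> i j. e s i * e s j * M (of_real s) $ i $ j) \<noteq> 0"
      by (auto simp: eventually_at_top_linorder)
    then have "det (M (of_real s)) \<noteq> 0" unfolding det_scale_rows_columns by auto
    then show "\<exists>s. det (M s) \<noteq> 0" by blast
  next
    show "\<forall>s u. det (M s) \<noteq> 0 \<longrightarrow>
        (\<Sum>m\<in>E. (a m * exp (of_real (l m) * s) * pairing m u) *s m) = 0 \<longrightarrow>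
        (\<forall>m\<in>E. pairing m u = 0)"
    proof (intro allI impI)
      fix s u
      assume nz: "det (M s) \<noteq> 0" and ker: "(\<Sum>m\<in>E. (a m * exp (of_real (l m) * s) * pairing m u) *s m) = 0"
      \<comment> \<open>Cutting off the entries outside \<open>G\<close> makes the padding of
        \<open>M\<close> act as zero. For \<open>m\<close> in \<open>E\<close> the value
        \<open>pairing m u\<close> is still recovered, since only coordinates in \<open>G\<close>
        occur there.\<close>
      define c :: "complex ^ 'n" where "c = (\<chi> j. if \<psi> j \<in> G then pairing (\<psi> j) u else 0)"
      have pair: "pairing m u = (\<Sum>j\<in>UNIV. \<mu> j m * c $ j)" if "m \<in> E" for m
      proof -
        have "pairing m u = (\<Sum>j\<in>UNIV. \<mu> j m * pairing (\<psi> j) u)"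
          using pairing_sum_left[of "\<lambda>j. \<mu> j m" \<psi> UNIV u] sumB[of m] by simp
        also have "\<dots> = (\<Sum>j\<in>UNIV. \<mu> j m * c $ j)"
          using \<mu>nz[OF that] by (intro sum.cong) (auto simp: c_def)
        finally show ?thesis .
      qed
      have "(M s *v c) $ i = 0" for i
      proof -
        have "(M s *v c) $ i = (\<Sum>j\<in>UNIV. \<Sum>m\<in>E. a m * exp (of_real (l m) * s) * \<mu> i m * \<mu> j m * c $ j) +
            (\<Sum>j\<in>UNIV. (if i = j \<and> \<psi> i \<notin> G then 1 else 0) * c $ j)"
          by (simp add: M_def matrix_vector_mult_def ring_distribs sum.distrib sum_distrib_right)
        also have "(\<Sum>j\<in>UNIV. (if i = j \<and> \<psi> i \<notin> G then 1 else 0) * c $ j) = 0"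
          by (intro sum.neutral) (auto simp: c_def)
        also have "(\<Sum>j\<in>UNIV. \<Sum>m\<in>E. a m * exp (of_real (l m) * s) * \<mu> i m * \<mu> j m * c $ j) =
            (\<Sum>m\<in>E. a m * exp (of_real (l m) * s) * pairing m u * \<mu> i m)"
          by (subst sum.swap) (simp add: pair sum_distrib_left sum_distrib_right mult_ac)
        also have "\<dots> = \<mu> i (\<Sum>m\<in>E. (a m * exp (of_real (l m) * s) * pairing m u) *s m)" by (simp add: \<mu>sum)
        also have "\<dots> = 0" unfolding ker using B by (simp add: \<mu>_def vec.representation_zero)
        finally show ?thesis by simp
      qed
      then have "M s *v c = 0" by (simp add: vec_eq_iff)
      then have "c = 0"
        using nz by (metis invertible_det_nz invertible_left_inverse matrix_left_invertible_ker)
      then show "\<forall>m\<in>E. pairing m u = 0" using pair by simp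
    qed
  qed
qed

section \<open>Exterior forms and their kernels\<close>

lemma alternating_form_linear:
  "alternating_form q \<phi> \<Longrightarrow> i < q \<Longrightarrow> Vector_Spaces.linear (*s) (*) (\<lambda>u. \<phi> (v(i := u)))"
  unfolding alternating_form_def by blast

lemma alternating_form_eq_0:
  "alternating_form q \<phi> \<Longrightarrow> i < q \<Longrightarrow> j < q \<Longrightarrow> i \<noteq> j \<Longrightarrow> v i = v j \<Longrightarrow> \<phi> v = 0"
  unfolding alternating_form_def by blast

lemma linear_functional_simps:
  fixes g :: "complex ^ 'n::finite \<Rightarrow> complex"
  assumes "Vector_Spaces.linear (*s) (*) g"
  shows "g (x + y) = g x + g y" "g (c *s x) = c * g x" "g (x - y) = g x - g y" "g 0 = 0"
    "g (\<Sum>i\<in>A. h i) = (\<Sum>i\<in>A. g (h i))"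
proof -
  interpret Vector_Spaces.linear "(*s)" "(*)" g by fact
  show "g (x + y) = g x + g y" "g (c *s x) = c * g x" "g (x - y) = g x - g y" "g 0 = 0"
    "g (\<Sum>i\<in>A. h i) = (\<Sum>i\<in>A. g (h i))"
    by (auto simp: add scale diff zero sum)
qed

text \<open>Polarization: expand the form with \<open>a + b\<close> in both slots, where it
  vanishes.\<close>

lemma alternating_form_swap:
  assumes \<phi>: "alternating_form q \<phi>" and ij: "i < q" "j < q" "i \<noteq> j"
  shows "\<phi> (v(i := a, j := b)) = - \<phi> (v(i := b, j := a))"
proof -
  note add = linear_functional_simps(1)[OF alternating_form_linear[OF \<phi>]]
  have split: "\<phi> (v(i := a + b, j := c)) = \<phi> (v(i := a, j := c)) + \<phi> (v(i := b, j := c))" for c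
    using add[OF ij(1), of "v(j := c)" a b] ij(3) by (simp add: fun_upd_twist)
  have diag: "\<phi> (v(i := c, j := c)) = 0" for c
    by (rule alternating_form_eq_0[OF \<phi> ij]) (use ij in simp)
  have "0 = \<phi> (v(i := a + b, j := a + b))" by (simp only: diag)
  also have "\<dots> = \<phi> (v(i := a + b, j := a)) + \<phi> (v(i := a + b, j := b))"
    by (rule add[OF ij(2)])
  finally show ?thesis by (simp add: split diag eq_neg_iff_add_eq_0 add.commute)
qed

text \<open>Composition with the transposition of \<open>i\<close> and \<open>j\<close> flips the
  sign and leaves the product unchanged, so the sum equals its own negative.\<close>

lemma wedge_one_forms_repeated:
  assumes "i < q" "j < q" "i \<noteq> j" and eq: "\<alpha> i = \<alpha> j"
  shows "wedge_one_forms q \<alpha> v = 0"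
proof -
  define g where "g \<sigma> = of_int (sign \<sigma>) * (\<Prod>i<q. \<alpha> i (v (\<sigma> i)))" for \<sigma>
  define \<tau> where "\<tau> = Transposition.transpose i j"
  have \<tau>: "\<tau> permutes {..<q}" using assms by (auto simp: \<tau>_def intro: permutes_swap_id)
  have "g (\<sigma> \<circ> \<tau>) = - g \<sigma>" if \<sigma>: "\<sigma> permutes {..<q}" for \<sigma>
  proof -
    have "sign (\<sigma> \<circ> \<tau>) = - sign \<sigma>"
      using permutes_imp_permutation[OF _ \<sigma>] permutation_swap_id[of i j] assms(3)
      by (simp add: sign_compose \<tau>_def sign_swap_id)
    moreover have "(\<Prod>k<q. \<alpha> k (v ((\<sigma> \<circ> \<tau>) k))) = (\<Prod>k<q. \<alpha> k (v (\<sigma> k)))"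
    proof -
      have "\<alpha> (\<tau> k) = \<alpha> k" for k using eq by (auto simp: \<tau>_def Transposition.transpose_def)
      then have "(\<Prod>k<q. \<alpha> k (v ((\<sigma> \<circ> \<tau>) k))) = (\<Prod>k<q. ((\<lambda>k. \<alpha> k (v (\<sigma> k))) \<circ> \<tau>) k)" by simp
      also have "\<dots> = (\<Prod>k<q. \<alpha> k (v (\<sigma> k)))"
        using prod.permute[OF \<tau>, of "\<lambda>k. \<alpha> k (v (\<sigma> k))"] by (simp add: comp_def)
      finally show ?thesis .
    qed
    ultimately show ?thesis by (simp add: g_def)
  qed
  moreover have "(\<Sum>\<sigma> | \<sigma> permutes {..<q}. g \<sigma>) = (\<Sum>\<sigma> | \<sigma> permutes {..<q}. g (\<sigma> \<circ> \<tau>))"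
    by (rule sum_permutations_compose_right) fact
  ultimately have "(\<Sum>\<sigma> | \<sigma> permutes {..<q}. g \<sigma>) = - (\<Sum>\<sigma> | \<sigma> permutes {..<q}. g \<sigma>)"
    by (simp add: sum_negf)
  then show ?thesis by (simp add: wedge_one_forms_def g_def)
qed

text \<open>Cramer's rule. Exchanging the factor \<open>\<alpha> l u\<close> for
  \<open>\<alpha> i (v (\<sigma> l))\<close> turns the left side into a sum over \<open>l\<close> of
  \<open>\<alpha> l u\<close> times the determinant with row \<open>l\<close> replaced by row
  \<open>i\<close>. Two equal rows kill every term but \<open>l = i\<close>.\<close>

lemma wedge_one_forms_cramer:
  assumes i: "i < q"
  shows "(\<Sum>j<q. \<alpha> i (v j) * wedge_one_forms q \<alpha> (v(j := u))) = \<alpha> i u * wedge_one_forms q \<alpha> v"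
proof -
  define P where "P = {\<sigma>. \<sigma> permutes {..<q}}"
  have "(\<Sum>j<q. \<alpha> i (v j) * wedge_one_forms q \<alpha> (v(j := u))) =
      (\<Sum>\<sigma>\<in>P. \<Sum>j<q. of_int (sign \<sigma>) * (\<alpha> i (v j) * (\<Prod>k<q. \<alpha> k ((v(j := u)) (\<sigma> k)))))"
    unfolding wedge_one_forms_def P_def [symmetric]
    by (subst sum.swap) (simp add: sum_distrib_left mult_ac)
  also have "\<dots> = (\<Sum>\<sigma>\<in>P. \<Sum>l<q. \<alpha> l u * (of_int (sign \<sigma>) * (\<Prod>k<q. (\<alpha>(l := \<alpha> i)) k (v (\<sigma> k)))))"
  proof (rule sum.cong[OF refl])
    fix \<sigma> assume "\<sigma> \<in> P"
    then have \<sigma>: "\<sigma> permutes {..<q}" by (simp add: P_def)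
    \<comment> \<open>The substitution \<open>j = \<sigma> l\<close> names the replaced column by
      the row it meets, so that exactly the factor \<open>k = l\<close> contains
      \<open>u\<close>.\<close>
    have "(\<Sum>j<q. of_int (sign \<sigma>) * (\<alpha> i (v j) * (\<Prod>k<q. \<alpha> k ((v(j := u)) (\<sigma> k))))) =
      (\<Sum>l<q. of_int (sign \<sigma>) * (\<alpha> i (v (\<sigma> l)) * (\<Prod>k<q. \<alpha> k ((v(\<sigma> l := u)) (\<sigma> k)))))"
      using sum.permute[OF \<sigma>, of "\<lambda>j. of_int (sign \<sigma>) * (\<alpha> i (v j) * (\<Prod>k<q. \<alpha> k ((v(j := u)) (\<sigma> k))))"]
      by (simp add: comp_def)
    also have "\<dots> = (\<Sum>l<q. \<alpha> l u * (of_int (sign \<sigma>) * (\<Prod>k<q. (\<alpha>(l := \<alpha> i)) k (v (\<sigma> k)))))"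
    proof (rule sum.cong[OF refl])
      fix l assume l: "l \<in> {..<q}"
      have inj: "\<sigma> k = \<sigma> l \<longleftrightarrow> k = l" for k using permutes_inj[OF \<sigma>] by (auto dest: injD)
      have "(\<Prod>k<q. \<alpha> k ((v(\<sigma> l := u)) (\<sigma> k))) =
          \<alpha> l u * (\<Prod>k\<in>{..<q} - {l}. \<alpha> k ((v(\<sigma> l := u)) (\<sigma> k)))"
        using l by (subst prod.remove[of _ l]) auto
      also have "(\<Prod>k\<in>{..<q} - {l}. \<alpha> k ((v(\<sigma> l := u)) (\<sigma> k))) = (\<Prod>k\<in>{..<q} - {l}. \<alpha> k (v (\<sigma> k)))"
        using inj by (intro prod.cong) auto
      moreover have "(\<Prod>k<q. (\<alpha>(l := \<alpha> i)) k (v (\<sigma> k))) =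
          \<alpha> i (v (\<sigma> l)) * (\<Prod>k\<in>{..<q} - {l}. (\<alpha>(l := \<alpha> i)) k (v (\<sigma> k)))"
        using l by (subst prod.remove[of _ l]) auto
      moreover have "(\<Prod>k\<in>{..<q} - {l}. (\<alpha>(l := \<alpha> i)) k (v (\<sigma> k))) = (\<Prod>k\<in>{..<q} - {l}. \<alpha> k (v (\<sigma> k)))"
        by (intro prod.cong) auto
      ultimately show "of_int (sign \<sigma>) * (\<alpha> i (v (\<sigma> l)) * (\<Prod>k<q. \<alpha> k ((v(\<sigma> l := u)) (\<sigma> k)))) =
          \<alpha> l u * (of_int (sign \<sigma>) * (\<Prod>k<q. (\<alpha>(l := \<alpha> i)) k (v (\<sigma> k))))"
        by (simp add: mult_ac)
    qed
    finally show "(\<Sum>j<q. of_int (sign \<sigma>) * (\<alpha> i (v j) * (\<Prod>k<q. \<alpha> k ((v(j := u)) (\<sigma> k))))) =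
      (\<Sum>l<q. \<alpha> l u * (of_int (sign \<sigma>) * (\<Prod>k<q. (\<alpha>(l := \<alpha> i)) k (v (\<sigma> k)))))" .
  qed
  also have "\<dots> = (\<Sum>l<q. \<alpha> l u * wedge_one_forms q (\<alpha>(l := \<alpha> i)) v)"
    unfolding wedge_one_forms_def P_def [symmetric] sum_distrib_left by (rule sum.swap)
  also have "\<dots> = (\<Sum>l<q. if l = i then \<alpha> i u * wedge_one_forms q \<alpha> v else 0)"
    using i wedge_one_forms_repeated[of i q _ "\<alpha>(_ := \<alpha> i)" v] by (intro sum.cong) auto
  also have "\<dots> = \<alpha> i u * wedge_one_forms q \<alpha> v" using i by simp
  finally show ?thesis .
qed

lemma wedge_one_forms_kernel:
  assumes "j < q" "\<And>i. i < q \<Longrightarrow> \<alpha> i (v j) = 0"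
  shows "wedge_one_forms q \<alpha> v = 0"
proof -
  have "(\<Prod>i<q. \<alpha> i (v (\<sigma> i))) = 0" if "\<sigma> permutes {..<q}" for \<sigma>
  proof -
    have "j \<in> \<sigma> ` {..<q}" using permutes_image[OF that] assms(1) by simp
    then obtain l where "l < q" "\<sigma> l = j" by auto
    then show ?thesis using assms(2) by (intro prod_zero) auto
  qed
  then show ?thesis unfolding wedge_one_forms_def by (intro sum.neutral) (simp del: prod_zero_iff)
qed

section \<open>Kernels of decomposable forms\<close>

definition contraction_kernel :: "'n::finite ext_form \<Rightarrow> (complex ^ 'n) set" where
  "contraction_kernel \<phi> = {u. \<forall>v. \<phi> (v(0 := u)) = 0}"

text \<open>For decomposable \<open>\<phi>\<close> with \<open>\<phi> v\<close> nonzero this is, up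
  to the factor \<open>\<phi> v\<close>, the projection to the kernel along the span of
  \<open>v 0, ..., v (q - 1)\<close>. Multiplying by \<open>\<phi> v\<close> instead of dividing
  keeps it linear in \<open>\<phi>\<close>, hence holomorphic when \<open>\<phi>\<close> varies
  holomorphically.\<close>

definition kernel_part :: "nat \<Rightarrow> 'n::finite ext_form \<Rightarrow> (nat \<Rightarrow> complex ^ 'n) \<Rightarrow> complex ^ 'n \<Rightarrow> complex ^ 'n" where
  "kernel_part q \<phi> v u = \<phi> v *s u - (\<Sum>j<q. \<phi> (v(j := u)) *s v j)"

lemma kernel_part_in_kernel:
  assumes q: "0 < q" and \<alpha>: "\<And>i. i < q \<Longrightarrow> Vector_Spaces.linear (*s) (*) (\<alpha> i)"
  shows "kernel_part q (wedge_one_forms q \<alpha>) v u \<in> contraction_kernel (wedge_one_forms q \<alpha>)"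
proof -
  have "\<alpha> i (kernel_part q (wedge_one_forms q \<alpha>) v u) = 0" if "i < q" for i
    using wedge_one_forms_cramer[OF that, of \<alpha> v u]
    by (simp add: kernel_part_def linear_functional_simps[OF \<alpha>[OF that]] mult_ac)
  then show ?thesis
    using q wedge_one_forms_kernel[of 0 q \<alpha>] by (auto simp: contraction_kernel_def)
qed

lemma subspace_contraction_kernel:
  assumes "alternating_form q \<phi>" "0 < q"
  shows "vec.subspace (contraction_kernel \<phi>)"
  unfolding vec.subspace_def contraction_kernel_def
  by (auto simp: linear_functional_simps[OF alternating_form_linear[OF assms]])

lemma contraction_kernel_any_slot:
  assumes \<phi>: "alternating_form q \<phi>" and u: "u \<in> contraction_kernel \<phi>" and j: "j < q"
  shows "\<phi> (v(j := u)) = 0"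
proof (cases "j = 0")
  case False
  then have "\<phi> (v(j := u)) = - \<phi> (v(j := v 0, 0 := u))"
    using alternating_form_swap[OF \<phi>, of 0 j v "v 0" u] j by (simp add: fun_upd_twist)
  then show ?thesis using u by (simp add: contraction_kernel_def)
qed (use u in \<open>simp add: contraction_kernel_def\<close>)

text \<open>The span of \<open>v 0, ..., v (q - 1)\<close> is a complement of the kernel: a
  combination of the \<open>v i\<close> put into slot \<open>j\<close> reveals its
  \<open>j\<close>-th coefficient, so the intersection is trivial, and \<open>kernel_part\<close>
  splits every vector.\<close>

lemma dim_contraction_kernel:
  fixes \<alpha> :: "nat \<Rightarrow> complex ^ 'n::finite \<Rightarrow> complex"
  assumes \<phi>: "alternating_form q \<phi>" "\<phi> = wedge_one_forms q \<alpha>" and q: "0 < q"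
    and \<alpha>: "\<And>i. i < q \<Longrightarrow> Vector_Spaces.linear (*s) (*) (\<alpha> i)" and nz: "\<phi> v \<noteq> 0"
  shows "vec.dim (contraction_kernel \<phi>) = CARD('n) - q"
proof -
  let ?K = "contraction_kernel \<phi>" and ?V = "v ` {..<q}"
  note lin = linear_functional_simps[OF alternating_form_linear[OF \<phi>(1)]]
  have coeff: "\<phi> (v(j := \<Sum>i<q. c i *s v i)) = c j * \<phi> v" if "j < q" for c j
  proof -
    have "\<phi> (v(j := \<Sum>i<q. c i *s v i)) = (\<Sum>i<q. c i * \<phi> (v(j := v i)))"
      by (simp add: lin[OF that])
    also have "\<dots> = (\<Sum>i<q. if i = j then c j * \<phi> v else 0)"
    proof (rule sum.cong[OF refl])
      fix i assume "i \<in> {..<q}"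
      then show "c i * \<phi> (v(j := v i)) = (if i = j then c j * \<phi> v else 0)"
        using alternating_form_eq_0[OF \<phi>(1) that, of i "v(j := v i)"] by auto
    qed
    finally show ?thesis using that by simp
  qed
  have inj: "inj_on v {..<q}"
    using alternating_form_eq_0[OF \<phi>(1), of _ _ v] nz by (auto simp: inj_on_def)
  have spanV: "\<exists>c. x = (\<Sum>i<q. c i *s v i)" if "x \<in> vec.span ?V" for x
    using that vec.span_finite[of ?V] inj by (auto simp: sum.reindex)
  have "vec.independent ?V"
  proof (rule vec.independent_if_scalars_zero)
    fix f x assume f: "(\<Sum>x\<in>?V. f x *s x) = 0" and "x \<in> ?V"
    then obtain j where j: "j < q" "x = v j" by auto
    have "(\<Sum>i<q. f (v i) *s v i) = 0" using f inj by (simp add: sum.reindex)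
    then show "f x = 0" using coeff[OF j(1), of "\<lambda>i. f (v i)"] nz lin(4)[OF j(1)] j by simp
  qed simp
  then have dimV: "vec.dim (vec.span ?V) = q"
    using inj by (simp add: vec.dim_eq_card_independent card_image)
  have "?K \<inter> vec.span ?V = {0}"
  proof -
    have "x = 0" if x: "x \<in> ?K" "x \<in> vec.span ?V" for x
    proof -
      obtain c where c: "x = (\<Sum>i<q. c i *s v i)" using spanV[OF x(2)] by blast
      have "c j = 0" if "j < q" for j
        using contraction_kernel_any_slot[OF \<phi>(1) x(1) that, of v] coeff[OF that, of c] nz c by simp
      then show ?thesis using c by simp
    qed
    then show ?thesis
      using vec.subspace_0[OF subspace_contraction_kernel[OF \<phi>(1) q]] vec.span_zero by auto
  qed
  moreover have "{x + y |x y. x \<in> ?K \<and> y \<in> vec.span ?V} = UNIV"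
  proof -
    have "\<exists>x y. u = x + y \<and> x \<in> ?K \<and> y \<in> vec.span ?V" for u
    proof (intro exI conjI)
      have "kernel_part q \<phi> v u \<in> ?K" unfolding \<phi>(2) by (rule kernel_part_in_kernel[OF q \<alpha>])
      then show "inverse (\<phi> v) *s kernel_part q \<phi> v u \<in> ?K"
        by (rule vec.subspace_scale[OF subspace_contraction_kernel[OF \<phi>(1) q]])
      show "inverse (\<phi> v) *s (\<Sum>j<q. \<phi> (v(j := u)) *s v j) \<in> vec.span ?V"
        by (intro vec.span_scale vec.span_sum vec.span_base) auto
      show "u = inverse (\<phi> v) *s kernel_part q \<phi> v u + inverse (\<phi> v) *s (\<Sum>j<q. \<phi> (v(j := u)) *s v j)"
        using nz by (simp add: kernel_part_def vec.scale_right_diff_distrib)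
    qed
    then show ?thesis by blast
  qed
  ultimately show ?thesis
    using vec.dim_sums_Int[OF subspace_contraction_kernel[OF \<phi>(1) q] vec.subspace_span, of ?V]
      dimV vec_dim_card[where 'n = 'n and 'a = complex] by simp
qed

text \<open>A basis of the kernel is extended to the whole space; the map is injective on the span
  of the added vectors, which already has the full image. Dimensions are complex.\<close>

lemma rank_nullity:
  fixes f :: "complex ^ 'n::finite \<Rightarrow> complex ^ 'm::finite"
  assumes f: "Vector_Spaces.linear (*s) (*s) f"
  shows "vec.dim (range f) + vec.dim {u. f u = 0} = CARD('n)"
proof -
  interpret f: Vector_Spaces.linear "(*s)" "(*s)" f by fact
  let ?K = "{u. f u = 0}"
  have K: "vec.subspace ?K" by (rule f.subspace_kernel)
  obtain B where B: "B \<subseteq> ?K" "vec.independent B" "?K \<subseteq> vec.span B" "card B = vec.dim ?K"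
    using vec.basis_exists by blast
  define C where "C = vec.extend_basis B"
  have C: "B \<subseteq> C" "vec.independent C" "vec.span C = UNIV"
    using vec.extend_basis_superset[OF B(2)] vec.independent_extend_basis[OF B(2)]
      vec.span_extend_basis[OF B(2)] by (auto simp: C_def)
  have fin: "finite C" using C(2) by (rule vec.finiteI_independent)
  have spanB: "vec.span B = ?K" using B K by (metis vec.span_subspace)
  let ?D = "vec.span (C - B)"
  have "B \<union> (C - B) = C" using C(1) by blast
  then have sum: "{x + y |x y. x \<in> ?K \<and> y \<in> ?D} = UNIV"
    using vec.span_Un[of B "C - B"] C(3) spanB by simp
  have "card C = CARD('n)"
    using vec.dim_eq_card_independent[OF C(2)] vec.dim_span[of C] C(3) vec_dim_card by metis
  moreover have dimD: "vec.dim ?D = card C - card B"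
    using vec.independent_mono[OF C(2)] C(1) fin
    by (metis Diff_subset card_Diff_subset finite_subset vec.dim_span_eq_card_independent)
  ultimately have cards: "vec.dim ?D + vec.dim ?K = CARD('n)"
    using B(4) card_mono[OF fin C(1)] by simp
  have "CARD('n) + vec.dim (?K \<inter> ?D) = vec.dim ?K + vec.dim ?D"
    using vec.dim_sums_Int[OF K vec.subspace_span, of "C - B"]
    unfolding sum vec_dim_card .
  then have "vec.dim (?K \<inter> ?D) = 0" using cards by linarith
  then have zero: "?K \<inter> ?D \<subseteq> {0}" by (simp add: vec.dim_eq_0)
  have "inj_on f ?D"
  proof (rule inj_onI)
    fix x y assume "x \<in> ?D" "y \<in> ?D" "f x = f y"
    then have "x - y \<in> ?K \<inter> ?D" by (auto simp: f.diff intro: vec.span_diff)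
    then show "x = y" using zero by auto
  qed
  then have "vec.dim (f ` ?D) = vec.dim ?D" by (intro vec.dim_image_eq[OF f]) (simp add: vec.span_span)
  moreover have "f ` ?D = range f"
  proof -
    have "f u \<in> f ` ?D" for u
    proof -
      obtain x y where "u = x + y" "x \<in> ?K" "y \<in> ?D" using sum by blast
      then show ?thesis by (auto simp: f.add)
    qed
    then show ?thesis by auto
  qed
  ultimately show ?thesis using cards by simp
qed

section \<open>Holomorphic vector fields and integral curves\<close>

lemma holomorphic_fun_continuous: "holomorphic_fun U g \<Longrightarrow> x \<in> U \<Longrightarrow> isCont g x"
  unfolding holomorphic_fun_def by (meson has_derivative_continuous)

text \<open>\<open>holomorphic_fun\<close> grants complex differentiability at each point but says
  nothing about continuity of the derivative. Cauchy's inequality on one-variable slices bounds the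
  derivative by a bound of the function, and the mean value inequality on the convex ball turns this
  into a Lipschitz estimate.\<close>

lemma holomorphic_fun_locally_lipschitz:
  fixes g :: "complex ^ 'n::finite \<Rightarrow> complex"
  assumes g: "holomorphic_fun U g" and x0: "x0 \<in> U"
  obtains r C where "r > 0" "C \<ge> 0" "cball x0 r \<subseteq> U"
    "\<And>x y. x \<in> cball x0 r \<Longrightarrow> y \<in> cball x0 r \<Longrightarrow> norm (g x - g y) \<le> C * norm (x - y)"
proof -
  have "open U" using g by (simp add: holomorphic_fun_def)
  obtain d where d: "d > 0" "ball x0 d \<subseteq> U" using \<open>open U\<close> x0 by (meson openE)
  obtain e where e: "e > 0" "\<And>y. dist y x0 < e \<Longrightarrow> dist (g y) (g x0) < 1"
    using tendstoD[OF holomorphic_fun_continuous[OF g x0, unfolded isCont_def], of 1]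
    unfolding eventually_at by auto (metis dist_self zero_less_one)
  \<comment> \<open>A slice of radius \<open>r\<close> around a point of \<open>cball x0 r\<close>
    stays within \<open>2 * r\<close> of \<open>x0\<close>, which is less than both \<open>d\<close>
    and \<open>e\<close>.\<close>
  define r where "r = min d e / 3"
  define M where "M = norm (g x0) + 1"
  have r: "r > 0" using d e by (simp add: r_def)
  have big: "y \<in> U" "norm (g y) \<le> M" if "dist y x0 \<le> 2 * r" for y
  proof -
    have "dist y x0 < d" "dist y x0 < e" using that r by (auto simp: r_def)
    then show "y \<in> U" using d(2) by (auto simp: dist_commute)
    have "dist (g y) (g x0) < 1" using e \<open>dist y x0 < e\<close> by blast
    then show "norm (g y) \<le> M"
      using norm_triangle_ineq2[of "g y" "g x0"] by (simp add: M_def dist_norm)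
  qed
  define D where "D y = frechet_derivative g (at y)" for y
  have D: "(g has_derivative D y) (at y)" "Vector_Spaces.linear (*s) (*) (D y)" if "y \<in> U" for y
  proof -
    have "\<exists>D'. (g has_derivative D') (at y) \<and> Vector_Spaces.linear (*s) (*) D'"
      using g that by (simp add: holomorphic_fun_def)
    then obtain D' where D': "(g has_derivative D') (at y)" "Vector_Spaces.linear (*s) (*) D'"
      by (elim exE conjE)
    have eq: "D' = D y" unfolding D_def by (rule frechet_derivative_at[OF D'(1)])
    show "(g has_derivative D y) (at y)" "Vector_Spaces.linear (*s) (*) (D y)"
      using D' unfolding eq by this+
  qed
  have bound: "onorm (D y) \<le> M / r" if y: "y \<in> cball x0 r" for y
  proof (rule onorm_bound)
    show "0 \<le> M / r" using r by (simp add: M_def)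
    fix h :: "complex ^ 'n"
    show "norm (D y h) \<le> M / r * norm h"
    proof (cases "h = 0")
      case True
      have "bounded_linear (D y)"
        using y r by (intro has_derivative_bounded_linear[OF D(1)] big(1)) (simp add: dist_commute)
      then have "D y 0 = 0" by (rule linear_simps(3))
      then show ?thesis using True by simp
    next
      case False
      have "y \<in> U" using y r by (intro big(1)) (simp add: dist_commute[of y x0])
      note Dlin = D(2)[OF this]
      define u where "u = inverse (of_real (norm h)) *s h"
      have u: "norm u = 1" using False by (simp add: u_def norm_vector_smult norm_inverse)
      define G where "G z = g (y + z *s u)" for z
      have near: "dist (y + z *s u) x0 \<le> 2 * r" if "norm z \<le> r" for z
      proof -
        have "norm (y + z *s u - x0) \<le> norm (y - x0) + norm (z *s u)"
          using norm_triangle_ineq[of "y - x0" "z *s u"] by (simp add: algebra_simps)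
        then show ?thesis using that y u by (simp add: norm_vector_smult dist_norm norm_minus_commute)
      qed
      have der: "(G has_field_derivative D (y + z *s u) u) (at z)" if "norm z \<le> r" for z
      proof -
        have "((\<lambda>z. y + z *s u) has_derivative (\<lambda>z. 0 + z *s u)) (at z)"
          by (intro derivative_intros bounded_linear_imp_has_derivative bounded_linear_vector_smult)
        from diff_chain_at[OF this D(1)[OF big(1)[OF near[OF that]]]]
        have "(G has_derivative (\<lambda>w. D (y + z *s u) (w *s u))) (at z)"
          by (simp add: G_def [abs_def] comp_def)
        moreover have "D (y + z *s u) (w *s u) = D (y + z *s u) u * w" for w
        proof -
          interpret Vector_Spaces.linear "(*s)" "(*)" "D (y + z *s u)"
            by (rule D(2)[OF big(1)[OF near[OF that]]])
          show ?thesis by (simp add: scale mult.commute)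
        qed
        ultimately show ?thesis by (simp add: has_field_derivative_def)
      qed
      have "norm ((deriv ^^ 1) G 0) \<le> fact 1 * M / r ^ 1"
      proof (rule Cauchy_inequality)
        show "G holomorphic_on ball 0 r"
          unfolding holomorphic_on_def
        proof
          fix z :: complex
          assume "z \<in> ball 0 r"
          then have "norm z \<le> r" by simp
          then have "G field_differentiable at z"
            unfolding field_differentiable_def by (intro exI) (rule der)
          then show "G field_differentiable at z within ball 0 r"
            by (rule field_differentiable_at_within)
        qed
        show "continuous_on (cball 0 r) G"
        proof (rule continuous_at_imp_continuous_on, rule ballI)
          fix z :: complex
          assume "z \<in> cball 0 r"
          then have "norm z \<le> r" by simp
          then show "isCont G z" by (rule DERIV_isCont[OF der])
        qed
        show "norm (G z) \<le> M" if "norm (0 - z) = r" for z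
          using that big(2)[OF near[of z]] by (simp add: G_def)
      qed (fact r)
      moreover have "deriv G 0 = D y u" using DERIV_imp_deriv[OF der[of 0]] r by simp
      ultimately have Du: "norm (D y u) \<le> M / r" by simp
      have h: "h = of_real (norm h) *s u" using False by (simp add: u_def)
      have Dh: "D y h = of_real (norm h) * D y u"
      proof -
        interpret Vector_Spaces.linear "(*s)" "(*)" "D y"
          by (rule Dlin)
        show ?thesis using h scale by (rule trans[OF arg_cong[where f = "D y"]])
      qed
      show ?thesis
        using mult_right_mono[OF Du norm_ge_zero[of h]] by (simp only: Dh norm_mult norm_of_real abs_norm_cancel mult.commute)
    qed
  qed
  show thesis
  proof (rule that[of r "M / r"])
    show sub: "cball x0 r \<subseteq> U"
    proof
      fix z assume "z \<in> cball x0 r"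
      then have "dist z x0 \<le> 2 * r" using r by (simp add: dist_commute[of z x0])
      then show "z \<in> U" by (rule big(1))
    qed
    have der: "(g has_derivative D z) (at z within cball x0 r)" if "z \<in> cball x0 r" for z
      by (rule has_derivative_at_withinI[OF D(1)[OF subsetD[OF sub that]]])
    show "norm (g x - g y) \<le> M / r * norm (x - y)" if "x \<in> cball x0 r" "y \<in> cball x0 r" for x y
      by (rule differentiable_bound[where f = g and f' = D, OF convex_cball der bound that])
    show "0 \<le> M / r" using r by (simp add: M_def)
  qed (fact r)
qed

lemma holomorphic_map_locally_lipschitz:
  fixes X :: "complex ^ 'n::finite \<Rightarrow> complex ^ 'n"
  assumes X: "holomorphic_map U X" and x0: "x0 \<in> U"
  obtains r C where "r > 0" "C \<ge> 0" "cball x0 r \<subseteq> U"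
    "\<And>x y. x \<in> cball x0 r \<Longrightarrow> y \<in> cball x0 r \<Longrightarrow> norm (X x - X y) \<le> C * norm (x - y)"
proof -
  have "\<exists>r C. r > 0 \<and> C \<ge> 0 \<and> cball x0 r \<subseteq> U \<and>
      (\<forall>x\<in>cball x0 r. \<forall>y\<in>cball x0 r. norm (X x $ i - X y $ i) \<le> C * norm (x - y))" for i
  proof -
    have "holomorphic_fun U (\<lambda>x. X x $ i)" using X by (simp add: holomorphic_map_def)
    from this x0 show ?thesis by (rule holomorphic_fun_locally_lipschitz) blast
  qed
  then obtain r C where rC: "\<And>i. r i > 0" "\<And>i. C i \<ge> 0" "\<And>i. cball x0 (r i) \<subseteq> U"
    "\<And>i x y. x \<in> cball x0 (r i) \<Longrightarrow> y \<in> cball x0 (r i) \<Longrightarrow> norm (X x $ i - X y $ i) \<le> C i * norm (x - y)"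
    by metis
  define R where "R = Min (range r)"
  have R: "R > 0" "\<And>i. R \<le> r i" using rC by (auto simp: R_def)
  show thesis
  proof (rule that[of R "\<Sum>i\<in>UNIV. C i"])
    show "cball x0 R \<subseteq> U" using subset_cball[OF R(2)] rC(3) by (rule subset_trans)
    show "norm (X x - X y) \<le> (\<Sum>i\<in>UNIV. C i) * norm (x - y)"
      if "x \<in> cball x0 R" "y \<in> cball x0 R" for x y
    proof -
      from that have "x \<in> cball x0 (r i)" "y \<in> cball x0 (r i)" for i using R(2)[of i] by auto
      then have "(\<Sum>i\<in>UNIV. norm ((X x - X y) $ i)) \<le> (\<Sum>i\<in>UNIV. C i * norm (x - y))"
        by (intro sum_mono) (simp add: rC(4))
      moreover have "norm (X x - X y) \<le> (\<Sum>i\<in>UNIV. norm ((X x - X y) $ i))"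
        unfolding norm_vec_def by (rule L2_set_le_sum) simp
      ultimately show ?thesis unfolding sum_distrib_right by (rule order_trans[rotated])
    qed
    show "0 \<le> (\<Sum>i\<in>UNIV. C i)" by (rule sum_nonneg) (rule rC(2))
  qed (fact R(1))
qed

text \<open>Banach's fixed point theorem for the integral equation. Time is rescaled so that
  solutions live on the fixed interval \<open>{0..1}\<close>; the short existence time
  \<open>\<delta>\<close> becomes a factor of the field.\<close>

lemma picard_local_existence:
  fixes X :: "'a::euclidean_space \<Rightarrow> 'a"
  assumes r: "r > 0" and C: "C \<ge> 0"
    and lip: "\<And>x y. x \<in> cball x0 r \<Longrightarrow> y \<in> cball x0 r \<Longrightarrow> norm (X x - X y) \<le> C * norm (x - y)"
  obtains \<gamma> \<delta> where "\<delta> > 0" "\<gamma> 0 = x0" "\<forall>t\<in>{0..1}. \<gamma> t \<in> cball x0 r"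
    "\<forall>t\<in>{0..1}. (\<gamma> has_vector_derivative \<delta> *\<^sub>R X (\<gamma> t)) (at t within {0..1})"
proof -
  define M where "M = norm (X x0) + C * r"
  have M: "norm (X x) \<le> M" if "x \<in> cball x0 r" for x
  proof -
    have "norm (X x - X x0) \<le> C * norm (x - x0)" using lip[OF that] r by simp
    also have "\<dots> \<le> C * r" using that C by (intro mult_left_mono) (auto simp: dist_norm norm_minus_commute)
    finally show ?thesis using norm_triangle_ineq2[of "X x" "X x0"] by (simp add: M_def)
  qed
  have M0: "M \<ge> 0" using C r by (simp add: M_def)
  \<comment> \<open>The first bound keeps the integral operator inside the ball, the second makes it
    contract by 1/2. Adding 1 to \<open>M\<close> and \<open>C\<close> avoids division by
    zero.\<close>
  define \<delta> where "\<delta> = min (r / (M + 1)) (1 / (2 * (C + 1)))"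
  have \<delta>: "\<delta> > 0" "\<delta> * M \<le> r" "\<delta> * C \<le> 1 / 2"
  proof -
    show "\<delta> > 0" using r M0 C by (simp add: \<delta>_def)
    have "\<delta> * M \<le> r / (M + 1) * M" using M0 by (intro mult_right_mono) (auto simp: \<delta>_def)
    also have "\<dots> \<le> r" using M0 r by (simp add: field_simps)
    finally show "\<delta> * M \<le> r" .
    have "\<delta> * C \<le> 1 / (2 * (C + 1)) * C" using C by (intro mult_right_mono) (auto simp: \<delta>_def)
    also have "\<dots> \<le> 1 / 2" using C by (simp add: field_simps)
    finally show "\<delta> * C \<le> 1 / 2" .
  qed
  have contX: "continuous_on (cball x0 r) X"
    using C lip by (intro lipschitz_on_continuous_on[of C] lipschitz_onI) (auto simp: dist_norm)
  \<comment> \<open>The complete space consists of functions on the whole real line;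
    \<open>clamp\<close> below extends the values of the integral operator constantly beyond
    \<open>{0..1}\<close>.\<close>
  define S where "S = {g :: real \<Rightarrow>\<^sub>C 'a. \<forall>t. g t \<in> cball x0 r}"
  have "S = PiC UNIV (\<lambda>_. cball x0 r)" by (simp add: S_def set_eq_iff mem_PiC_iff Pi_iff)
  then have "closed S" by (simp add: closed_PiC)
  then have complete: "complete S" by (simp add: complete_eq_closed)
  have "S \<noteq> {}" using r by (auto simp: S_def intro!: exI[of _ "const_bcontfun x0"])
  define I where "I g t = x0 + \<delta> *\<^sub>R integral {0..t} (\<lambda>s. X (apply_bcontfun g s))" for g :: "real \<Rightarrow>\<^sub>C 'a" and t
  have contXg: "continuous_on A (\<lambda>s. X (apply_bcontfun g s))" if "g \<in> S" for g A
    using that by (intro continuous_on_compose2[OF contX]) (auto simp: S_def)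
  have intXg: "(\<lambda>s. X (apply_bcontfun g s)) integrable_on {0..t}" if "g \<in> S" for g t
    using contXg[OF that] by (rule integrable_continuous_real)
  have derI: "(I g has_vector_derivative \<delta> *\<^sub>R X (apply_bcontfun g t)) (at t within {0..1})"
    if "g \<in> S" "t \<in> {0..1}" for g t
  proof -
    have "((\<lambda>t. integral {0..t} (\<lambda>s. X (apply_bcontfun g s))) has_vector_derivative
        X (apply_bcontfun g t)) (at t within {0..1})"
      by (rule integral_has_vector_derivative[OF contXg[OF that(1)] that(2)])
    from has_vector_derivative_add[OF has_vector_derivative_const
        bounded_linear.has_vector_derivative[OF bounded_linear_scaleR_right this]]
    show ?thesis by (simp add: I_def [abs_def])
  qed
  have I_ball: "I g t \<in> cball x0 r" if "g \<in> S" "t \<in> {0..1}" for g t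
  proof -
    have "norm (integral {0..t} (\<lambda>s. X (apply_bcontfun g s))) \<le> M * (t - 0)"
    proof (rule integral_bound[OF _ contXg[OF that(1)]])
      show "norm (X (apply_bcontfun g s)) \<le> M" for s using that(1) by (intro M) (simp add: S_def)
    qed (use that in simp)
    also have "\<dots> \<le> M" using that M0 by (simp add: mult_left_le)
    finally have "\<delta> * norm (integral {0..t} (\<lambda>s. X (apply_bcontfun g s))) \<le> \<delta> * M"
      using \<delta>(1) by simp
    also have "\<dots> \<le> r" by (fact \<delta>(2))
    finally show ?thesis using \<delta> by (simp add: I_def dist_norm)
  qed
  have "\<exists>h. \<forall>t. apply_bcontfun h t = I g (clamp 0 1 t)" if "g \<in> S" for g
  proof -
    have "continuous_on {0..1} (I g)"
      unfolding continuous_on_eq_continuous_within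
      by (intro ballI has_vector_derivative_continuous[OF derI[OF that]])
    then have "continuous_on (cbox 0 1) (I g)" by simp
    then show ?thesis by (rule continuous_on_cbox_bcontfunE) blast
  qed
  then obtain T where T: "\<And>g t. g \<in> S \<Longrightarrow> apply_bcontfun (T g) t = I g (clamp 0 1 t)" by metis
  have clamp: "clamp 0 1 t \<in> {0..1::real}" for t
    using clamp_in_interval[of 0 1 t] by auto
  have "\<exists>!g\<in>S. T g = g"
  proof (rule Banach_fix[OF complete \<open>S \<noteq> {}\<close>, of "1/2"])
    show "T ` S \<subseteq> S" using I_ball clamp by (auto simp: S_def T)
    fix g h assume gh: "g \<in> S" "h \<in> S"
    show "dist (T g) (T h) \<le> 1 / 2 * dist g h"
    proof (rule dist_bound)
      fix t :: real
      define s where "s = clamp 0 1 t"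
      have s: "s \<in> {0..1}" using clamp by (simp add: s_def)
      have "norm (integral {0..s} (\<lambda>s. X (apply_bcontfun g s) - X (apply_bcontfun h s)))
          \<le> C * dist g h * (s - 0)"
      proof (rule integral_bound[OF _ continuous_on_diff[OF contXg[OF gh(1)] contXg[OF gh(2)]]])
        fix \<tau>
        have "norm (X (apply_bcontfun g \<tau>) - X (apply_bcontfun h \<tau>)) \<le> C * dist (g \<tau>) (h \<tau>)"
          using gh lip by (auto simp: S_def dist_norm)
        also have "\<dots> \<le> C * dist g h" using C dist_bounded by (intro mult_left_mono) auto
        finally show "norm (X (apply_bcontfun g \<tau>) - X (apply_bcontfun h \<tau>)) \<le> C * dist g h" .
      qed (use s in auto)
      also have "\<dots> \<le> C * dist g h" using s C by (simp add: mult_left_le)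
      finally have "\<delta> * norm (integral {0..s} (\<lambda>s. X (apply_bcontfun g s) - X (apply_bcontfun h s)))
          \<le> \<delta> * (C * dist g h)"
        using \<delta> by simp
      also have "\<dots> \<le> 1 / 2 * dist g h"
        using mult_right_mono[OF \<delta>(3) zero_le_dist[of g h]] by (simp only: mult.assoc)
      finally have "norm (\<delta> *\<^sub>R integral {0..s} (\<lambda>s. X (apply_bcontfun g s) - X (apply_bcontfun h s)))
          \<le> 1 / 2 * dist g h"
        using \<delta>(1) by simp
      moreover have "I g s - I h s = \<delta> *\<^sub>R integral {0..s} (\<lambda>s. X (apply_bcontfun g s) - X (apply_bcontfun h s))"
        by (simp add: I_def integral_diff[OF intXg[OF gh(1)] intXg[OF gh(2)]] scaleR_diff_right)
      ultimately show "dist (apply_bcontfun (T g) t) (apply_bcontfun (T h) t) \<le> 1 / 2 * dist g h"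
        using gh by (simp add: T dist_norm s_def)
    qed
  qed auto
  then obtain g where g: "g \<in> S" "T g = g" by blast
  have gI: "apply_bcontfun g t = I g t" if "t \<in> {0..1}" for t
    using T[OF g(1), of t] g(2) clamp_cancel_cbox[of t 0 1] that by simp
  show thesis
  proof (rule that[of \<delta> "apply_bcontfun g"])
    show "apply_bcontfun g 0 = x0" using gI[of 0] by (simp add: I_def)
    show "\<forall>t\<in>{0..1}. apply_bcontfun g t \<in> cball x0 r" using g by (simp add: S_def)
    show "\<forall>t\<in>{0..1}. (apply_bcontfun g has_vector_derivative \<delta> *\<^sub>R X (apply_bcontfun g t))
        (at t within {0..1})"
    proof
      fix t :: real
      assume t: "t \<in> {0..1}"
      show "(apply_bcontfun g has_vector_derivative \<delta> *\<^sub>R X (apply_bcontfun g t)) (at t within {0..1})"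
        by (rule has_vector_derivative_transform[OF t gI derI[OF g(1) t]])
    qed
  qed (fact \<delta>)
qed

section \<open>The derivative of the logarithmic polar map\<close>

definition laurent_monomial :: "int ^ 'n::finite \<Rightarrow> complex ^ 'n \<Rightarrow> complex" where
  "laurent_monomial m x = (\<Prod>i\<in>UNIV. x $ i powi (m $ i))"

definition exponent_vector :: "int ^ 'n::finite \<Rightarrow> complex ^ 'n" where
  "exponent_vector m = (\<chi> i. of_int (m $ i))"

text \<open>The directions \<open>w\<close> whose one-parameter subgroup fixes every monomial of
  \<open>f\<close>: along it \<open>x^m\<close> is multiplied by the exponential of \<open>t\<close>
  times the pairing of \<open>m\<close> and \<open>w\<close>.\<close>

definition annihilator :: "'n::finite laurent \<Rightarrow> (complex ^ 'n) set" where
  "annihilator f = {w. \<forall>m\<in>Poly_Mapping.keys f. pairing (exponent_vector m) w = 0}"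

definition log_hessian_map :: "'n::finite laurent \<Rightarrow> complex ^ 'n \<Rightarrow> complex ^ 'n \<Rightarrow> complex ^ 'n" where
  "log_hessian_map f x w = (\<Sum>m\<in>Poly_Mapping.keys f.
     (Poly_Mapping.lookup f m * laurent_monomial m x * pairing (exponent_vector m) w) *s exponent_vector m)"

lemma open_torus: "open (torus :: (complex ^ 'n::finite) set)"
proof -
  have eq: "torus = (\<Inter>i. {x :: complex ^ 'n. x $ i \<noteq> 0})" by (auto simp: torus_def)
  have "open {x :: complex ^ 'n. x $ i \<noteq> 0}" for i
    by (intro open_Collect_neq continuous_intros)
  then show ?thesis unfolding eq by (intro open_INT finite ballI)
qed

lemma laurent_monomial_nonzero: "x \<in> torus \<Longrightarrow> laurent_monomial m x \<noteq> 0"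
  by (auto simp: laurent_monomial_def torus_def)

lemma laurent_monomial_diff_axis:
  assumes "x \<in> torus"
  shows "x $ i * laurent_monomial (m - axis i 1) x = laurent_monomial m x"
proof -
  have nz: "x $ j \<noteq> 0" for j using assms by (simp add: torus_def)
  have "laurent_monomial (m - axis i 1) x = (\<Prod>j\<in>UNIV. x $ j powi (m $ j) / (if j = i then x $ i else 1))"
    unfolding laurent_monomial_def
    by (intro prod.cong) (auto simp: power_int_diff nz axis_def)
  also have "\<dots> = laurent_monomial m x / x $ i"
    by (simp add: laurent_monomial_def prod_dividef)
  finally show ?thesis using nz by simp
qed

lemma leval_single: "leval (Poly_Mapping.single m c) x = c * laurent_monomial m x"
  by (simp add: leval_def laurent_monomial_def)

lemma leval_superset:
  assumes "finite S" "Poly_Mapping.keys f \<subseteq> S"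
  shows "leval f x = (\<Sum>m\<in>S. Poly_Mapping.lookup f m * laurent_monomial m x)"
  unfolding leval_def laurent_monomial_def
  by (rule sum.mono_neutral_left) (use assms in \<open>auto simp: in_keys_iff\<close>)

lemma leval_add: "leval (f + g) x = leval f x + leval g x"
proof -
  let ?S = "Poly_Mapping.keys f \<union> Poly_Mapping.keys g"
  have "leval (f + g) x = (\<Sum>m\<in>?S. Poly_Mapping.lookup (f + g) m * laurent_monomial m x)"
    by (intro leval_superset Poly_Mapping.keys_add) auto
  also have "\<dots> = leval f x + leval g x"
    using leval_superset[of ?S f x] leval_superset[of ?S g x]
    by (simp add: lookup_add ring_distribs sum.distrib)
  finally show ?thesis .
qed

lemma leval_sum: "leval (\<Sum>a\<in>A. f a) x = (\<Sum>a\<in>A. leval (f a) x)"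
proof (induction A rule: infinite_finite_induct)
  case (insert a A)
  then show ?case by (simp add: leval_add)
qed (simp_all add: leval_def)

text \<open>Monomials are eigenvectors of \<open>x_i d/dx_i\<close> with eigenvalue
  \<open>m_i\<close>. On the torus the factor \<open>x $ i\<close> undoes the exponent shift in
  \<open>lpderiv\<close>.\<close>

lemma log_polar_eq:
  assumes "x \<in> torus"
  shows "log_polar f x = (\<Sum>m\<in>Poly_Mapping.keys f.
     (Poly_Mapping.lookup f m * laurent_monomial m x) *s exponent_vector m)"
proof (subst vec_eq_iff, rule allI)
  fix i
  have "log_polar f x $ i = (\<Sum>m\<in>Poly_Mapping.keys f. of_int (m $ i) * Poly_Mapping.lookup f m *
      (x $ i * laurent_monomial (m - axis i 1) x))"
    by (simp add: log_polar_def lpderiv_def leval_sum leval_single sum_distrib_left mult_ac)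
  also have "\<dots> = (\<Sum>m\<in>Poly_Mapping.keys f.
     (Poly_Mapping.lookup f m * laurent_monomial m x) *s exponent_vector m) $ i"
    unfolding laurent_monomial_diff_axis[OF assms] by (simp add: exponent_vector_def mult_ac)
  finally show "log_polar f x $ i = (\<Sum>m\<in>Poly_Mapping.keys f.
     (Poly_Mapping.lookup f m * laurent_monomial m x) *s exponent_vector m) $ i" .
qed

text \<open>Logarithmic differentiation; \<open>torus_inverse x * h\<close> is the componentwise
  quotient of \<open>h\<close> by \<open>x\<close>.\<close>

lemma has_derivative_laurent_monomial:
  assumes "x \<in> torus"
  shows "(laurent_monomial m has_derivative
     (\<lambda>h. laurent_monomial m x * pairing (exponent_vector m) (torus_inverse x * h))) (at x)"
proof -
  have nz: "x $ j \<noteq> 0" for j using assms by (simp add: torus_def)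
  have "((\<lambda>x. \<Prod>i\<in>UNIV. x $ i powi (m $ i)) has_derivative
     (\<lambda>h. \<Sum>i\<in>UNIV. (h $ i * (of_int (m $ i) * x $ i powi (m $ i - 1))) *
        (\<Prod>j\<in>UNIV - {i}. x $ j powi (m $ j)))) (at x)"
    by (intro has_derivative_prod has_derivative_power_int bounded_linear_imp_has_derivative
        bounded_linear_vec_nth nz)
  moreover have "(\<Sum>i\<in>UNIV. (h $ i * (of_int (m $ i) * x $ i powi (m $ i - 1))) *
        (\<Prod>j\<in>UNIV - {i}. x $ j powi (m $ j))) =
      laurent_monomial m x * pairing (exponent_vector m) (torus_inverse x * h)" for h
    unfolding pairing_def sum_distrib_left
  proof (rule sum.cong[OF refl])
    fix i
    have "laurent_monomial m x = x $ i powi (m $ i) * (\<Prod>j\<in>UNIV - {i}. x $ j powi (m $ j))"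
      unfolding laurent_monomial_def by (rule prod.remove) auto
    then show "(h $ i * (of_int (m $ i) * x $ i powi (m $ i - 1))) *
        (\<Prod>j\<in>UNIV - {i}. x $ j powi (m $ j)) =
        laurent_monomial m x * (exponent_vector m $ i * (torus_inverse x * h) $ i)"
      using nz[of i] by (simp add: power_int_diff exponent_vector_def torus_inverse_def field_simps)
  qed
  ultimately show ?thesis by (simp add: laurent_monomial_def [abs_def])
qed

lemma has_derivative_log_polar:
  assumes x: "x \<in> torus"
  shows "(log_polar f has_derivative (\<lambda>h. log_hessian_map f x (torus_inverse x * h))) (at x)"
proof (rule has_derivative_transform_within_open[OF _ open_torus x])
  show "((\<lambda>x. \<Sum>m\<in>Poly_Mapping.keys f.
      (Poly_Mapping.lookup f m * laurent_monomial m x) *s exponent_vector m) has_derivative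
      (\<lambda>h. log_hessian_map f x (torus_inverse x * h))) (at x)"
    unfolding log_hessian_map_def
  proof (rule has_derivative_sum)
    fix m assume "m \<in> Poly_Mapping.keys f"
    have "bounded_linear (\<lambda>c. (Poly_Mapping.lookup f m * c) *s exponent_vector m)"
      by (rule bounded_linear_compose[OF bounded_linear_vector_smult bounded_linear_mult_right])
    from bounded_linear.has_derivative[OF this has_derivative_laurent_monomial[OF x, of m]]
    show "((\<lambda>x. (Poly_Mapping.lookup f m * laurent_monomial m x) *s exponent_vector m) has_derivative
        (\<lambda>h. (Poly_Mapping.lookup f m * laurent_monomial m x *
           pairing (exponent_vector m) (torus_inverse x * h)) *s exponent_vector m)) (at x)"
      by (simp add: mult.assoc)
  qed
qed (simp add: log_polar_eq)

section \<open>Linear algebra of the logarithmic Hessian\<close>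

lemma pairing_add_right: "pairing m (u + w) = pairing m u + pairing m w"
  and pairing_smult_right: "pairing m (c *s w) = c * pairing m w"
  by (simp_all add: pairing_def ring_distribs sum.distrib sum_distrib_left mult_ac)

lemma subspace_annihilator: "vec.subspace (annihilator f)"
  unfolding vec.subspace_def annihilator_def
  by (auto simp: pairing_add_right pairing_smult_right) (simp add: pairing_def)

lemma log_hessian_map_annihilator: "w \<in> annihilator f \<Longrightarrow> log_hessian_map f x w = 0"
  by (simp add: log_hessian_map_def annihilator_def)

lemma linear_log_hessian_map:
  "Vector_Spaces.linear (*s) (*s) (\<lambda>h. log_hessian_map f x (y * h))"
proof -
  have "pairing m (y * (u + w)) = pairing m (y * u) + pairing m (y * w)"
    "pairing m (y * (c *s w)) = c * pairing m (y * w)" for m u w c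
    unfolding pairing_add_right [symmetric] pairing_smult_right [symmetric]
    by (simp_all add: pairing_def ring_distribs mult_ac)
  then show ?thesis
    by (unfold Vector_Spaces.linear_iff)
      (simp add: vec.vector_space_axioms log_hessian_map_def ring_distribs vec.scale_left_distrib sum.distrib
        vec.scale_sum_right mult_ac)
qed

text \<open>Two distinct exponents get the same weight only for \<open>c\<close> on a hyperplane,
  and finitely many hyperplanes form a null set. Real weights are admissible because the subgroup
  used later is analytic, not algebraic.\<close>

lemma exists_separating_functional:
  assumes "finite (K :: (int ^ 'n::finite) set)"
  obtains c :: "real ^ 'n" where "inj_on (\<lambda>m. \<Sum>i\<in>UNIV. c $ i * of_int (m $ i)) K"
proof -
  define d :: "(int ^ 'n) \<times> (int ^ 'n) \<Rightarrow> real ^ 'n" where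
    "d p = (\<chi> i. of_int (fst p $ i) - of_int (snd p $ i))" for p
  define P where "P = {p \<in> K \<times> K. fst p \<noteq> snd p}"
  have "d p \<noteq> 0" if "p \<in> P" for p
    using that by (auto simp: P_def d_def vec_eq_iff)
  then have "negligible (\<Union>p\<in>P. {c. d p \<bullet> c = 0})"
    using assms by (intro negligible_Union) (auto simp: P_def intro!: negligible_hyperplane)
  then have "(\<Union>p\<in>P. {c. d p \<bullet> c = 0}) \<noteq> UNIV" by (metis non_negligible_UNIV)
  then obtain c where c: "\<And>p. p \<in> P \<Longrightarrow> d p \<bullet> c \<noteq> 0" by auto
  show thesis
  proof (rule that[of c], rule inj_onI, rule ccontr)
    fix m m' assume "m \<in> K" "m' \<in> K" "m \<noteq> m'"
      and "(\<Sum>i\<in>UNIV. c $ i * of_int (m $ i)) = (\<Sum>i\<in>UNIV. c $ i * of_int (m' $ i))"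
    then have "d (m, m') \<bullet> c = 0"
      by (simp add: d_def inner_vec_def algebra_simps sum_subtractf)
    then show False using c[of "(m, m')"] \<open>m \<in> K\<close> \<open>m' \<in> K\<close> \<open>m \<noteq> m'\<close> by (simp add: P_def)
  qed
qed

lemma inj_exponent_vector: "inj exponent_vector"
  by (auto simp: inj_def exponent_vector_def vec_eq_iff)

text \<open>Moving from \<open>x\<close> to \<open>y s\<close> multiplies each monomial by an
  exponential in \<open>s\<close>, with pairwise distinct weights, so
  \<open>exponential_sum_kernel\<close> applies. Its function \<open>D\<close> is known to be
  nonzero only somewhere, possibly far away; the identity theorem forbids it to vanish on the
  preimage of \<open>U\<close>, which contains 0.\<close>

lemma generic_points_dense:
  assumes x: "x \<in> torus" and U: "open U" "x \<in> U"
  obtains y where "y \<in> U" "y \<in> torus" "\<And>w. log_hessian_map f y w = 0 \<Longrightarrow> w \<in> annihilator f"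
proof -
  let ?K = "Poly_Mapping.keys f"
  obtain c :: "real ^ 'a" where c: "inj_on (\<lambda>m. \<Sum>i\<in>UNIV. c $ i * of_int (m $ i)) ?K"
    using exists_separating_functional[of ?K] by auto
  define E where "E = exponent_vector ` ?K"
  define l where "l v = (\<Sum>i\<in>UNIV. c $ i * Re (v $ i))" for v :: "complex ^ 'a"
  \<comment> \<open>The value of the monomial at \<open>x\<close>, nonzero on the torus, is absorbed
    into the coefficient, so that the parameter 0 corresponds to \<open>x\<close> itself.\<close>
  define a where "a v = (let m = the_inv exponent_vector v in Poly_Mapping.lookup f m * laurent_monomial m x)" for v
  have inv: "the_inv exponent_vector (exponent_vector m) = m" for m :: "int ^ 'a"
    by (rule the_inv_f_f[OF inj_exponent_vector])
  have lE: "l (exponent_vector m) = (\<Sum>i\<in>UNIV. c $ i * of_int (m $ i))" for m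
    by (simp add: l_def exponent_vector_def)
  have fin: "finite E" by (simp add: E_def)
  have nz: "a m \<noteq> 0" if "m \<in> E" for m
    using that laurent_monomial_nonzero[OF x] by (auto simp: a_def E_def inv in_keys_iff)
  have inj: "inj_on l E"
    unfolding E_def using c by (intro inj_on_imageI) (simp add: comp_def lE)
  obtain D where D: "D holomorphic_on UNIV" "\<exists>s. D s \<noteq> 0"
    "\<forall>s u. D s \<noteq> 0 \<longrightarrow> (\<Sum>m\<in>E. (a m * exp (of_real (l m) * s) * pairing m u) *s m) = 0 \<longrightarrow>
       (\<forall>m\<in>E. pairing m u = 0)"
    using exponential_sum_kernel[where a = a and l = l, OF fin nz inj] by blast
  define y where "y s = (\<chi> i. x $ i * exp (of_real (c $ i) * s))" for s :: complex
  have "continuous_on UNIV y"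
    unfolding y_def by (intro continuous_intros)
  then have open_V: "open (y -` U)" using U(1) by (simp add: continuous_on_open_vimage)
  have "y 0 = x" by (simp add: y_def vec_eq_iff)
  then have V: "y -` U \<noteq> {}" using U(2) by auto
  have "\<exists>s\<in>y -` U. D s \<noteq> 0"
  proof (rule ccontr)
    assume "\<not> ?thesis"
    then have "D s = 0" for s
      using analytic_continuation_open[OF open_V open_UNIV V, of D "\<lambda>_. 0" s] D(1) by auto
    then show False using D(2) by blast
  qed
  then obtain s where s: "y s \<in> U" "D s \<noteq> 0" by blast
  show thesis
  proof (rule that[OF s(1)])
    show "y s \<in> torus" using x by (auto simp: torus_def y_def)
    have mono: "laurent_monomial m (y s) = laurent_monomial m x * exp (l (exponent_vector m) * s)" for m
      by (simp add: laurent_monomial_def y_def power_int_mult_distrib exp_power_int prod.distrib lE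
          exp_sum sum_distrib_right flip: exp_sum) (simp add: mult_ac)
    fix w assume w: "log_hessian_map f (y s) w = 0"
    have "(\<Sum>m\<in>E. (a m * exp (of_real (l m) * s) * pairing m w) *s m) = log_hessian_map f (y s) w"
      unfolding E_def log_hessian_map_def
      by (subst sum.reindex) (auto simp: a_def inv mono mult_ac intro: inj_on_subset[OF inj_exponent_vector])
    then have "\<forall>m\<in>E. pairing m w = 0" using D(3)[rule_format, OF s(2)] w by simp
    then show "w \<in> annihilator f" by (simp add: annihilator_def E_def)
  qed
qed

section \<open>Ranks of the polar map and the fiber dimension\<close>

lemma dim_torus_translate:
  assumes "x \<in> torus"
  shows "vec.dim {u. torus_inverse x * u \<in> W} = vec.dim W"
proof -
  have nz: "x $ j \<noteq> 0" for j using assms by (simp add: torus_def)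
  have inv: "torus_inverse x * (x * u) = u" "x * (torus_inverse x * u) = u" for u
    using nz by (auto simp: torus_inverse_def vec_eq_iff)
  have lin: "Vector_Spaces.linear (*s) (*s) ((*) x)"
    by (unfold Vector_Spaces.linear_iff) (simp add: vec.vector_space_axioms, simp add: vec_eq_iff algebra_simps)
  have "{u. torus_inverse x * u \<in> W} = (*) x ` W"
    using inv by (auto simp: image_iff) metis
  moreover have "inj ((*) x)" using inv(1) by (metis injI)
  then have "vec.dim ((*) x ` W) = vec.dim W"
    by (intro vec.dim_image_eq[OF lin]) (auto intro: inj_on_subset)
  ultimately show ?thesis by simp
qed

lemma polar_rank_at_eq:
  fixes f :: "'n::finite laurent"
  assumes "x \<in> torus"
  shows "polar_rank_at f x + vec.dim {w. log_hessian_map f x w = 0} = CARD('n)"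
proof -
  have "frechet_derivative (log_polar f) (at x) = (\<lambda>h. log_hessian_map f x (torus_inverse x * h))"
    by (rule frechet_derivative_at[OF has_derivative_log_polar[OF assms], symmetric])
  then show ?thesis
    using rank_nullity[OF linear_log_hessian_map[of f x "torus_inverse x"]]
      dim_torus_translate[OF assms, of "{w. log_hessian_map f x w = 0}"]
    by (simp add: polar_rank_at_def)
qed

text \<open>The Hessian kernel contains the annihilator at every point, which bounds all ranks by
  its codimension, and a generic point attains the bound. The bound also makes the set of ranks
  finite, as \<open>Max\<close> requires.\<close>

lemma polar_fiber_dim_eq: "polar_fiber_dim f = vec.dim (annihilator f)"
  for f :: "'n::finite laurent"
proof -
  have le: "vec.dim (annihilator f) \<le> CARD('n)"
    using vec.dim_subset_UNIV[of "annihilator f"] by (simp only: vec.dimension_def card_cart_basis)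
  have upper: "polar_rank_at f x \<le> CARD('n) - vec.dim (annihilator f)" if "x \<in> torus" for x
  proof -
    have "vec.dim (annihilator f) \<le> vec.dim {w. log_hessian_map f x w = 0}"
      by (rule vec.dim_subset) (auto simp: log_hessian_map_annihilator)
    then show ?thesis using polar_rank_at_eq[OF that, of f] by simp
  qed
  obtain y where y: "y \<in> torus" "\<And>w. log_hessian_map f y w = 0 \<Longrightarrow> w \<in> annihilator f"
    using generic_points_dense[of 1 UNIV f] by (auto simp: torus_def)
  then have "{w. log_hessian_map f y w = 0} = annihilator f"
    using log_hessian_map_annihilator by blast
  then have "polar_rank_at f y = CARD('n) - vec.dim (annihilator f)"
    using polar_rank_at_eq[OF y(1), of f] by simp
  then have "generic_polar_rank f = CARD('n) - vec.dim (annihilator f)"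
    unfolding generic_polar_rank_def
  proof (intro Max_eqI)
    show "finite (polar_rank_at f ` torus)"
      by (rule finite_subset[of _ "{..CARD('n)}"]) (use upper in fastforce)+
    assume eq: "polar_rank_at f y = CARD('n) - vec.dim (annihilator f)"
    show "CARD('n) - vec.dim (annihilator f) \<in> polar_rank_at f ` torus"
      using y(1) by (metis eq imageI)
  qed (use upper in auto)
  then show ?thesis using le by (simp add: polar_fiber_dim_def)
qed

section \<open>Tangent spaces of the polar foliation\<close>

lemma holomorphic_fun_subset:
  "holomorphic_fun U g \<Longrightarrow> open V \<Longrightarrow> V \<subseteq> U \<Longrightarrow> holomorphic_fun V g"
  unfolding holomorphic_fun_def by blast

lemma holomorphic_fun_mult_right:
  assumes "holomorphic_fun U g"
  shows "holomorphic_fun U (\<lambda>x. g x * c)"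
  unfolding holomorphic_fun_def
proof (intro conjI ballI)
  show "open U" using assms by (simp add: holomorphic_fun_def)
  fix x assume "x \<in> U"
  then have "\<exists>D. (g has_derivative D) (at x) \<and> Vector_Spaces.linear (*s) (*) D"
    using assms by (simp add: holomorphic_fun_def)
  then obtain D where D: "(g has_derivative D) (at x)" "Vector_Spaces.linear (*s) (*) D"
    by (elim exE conjE)
  have "Vector_Spaces.linear (*s) (*) (\<lambda>h. D h * c)"
    using D(2) by (simp add: Vector_Spaces.linear_iff ring_distribs mult_ac)
  with has_derivative_mult_left[OF D(1), of c]
  show "\<exists>D. ((\<lambda>x. g x * c) has_derivative D) (at x) \<and> Vector_Spaces.linear (*s) (*) D"
    by (intro exI conjI)
qed

lemma holomorphic_fun_diff:
  assumes "holomorphic_fun U g" "holomorphic_fun U h"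
  shows "holomorphic_fun U (\<lambda>x. g x - h x)"
  unfolding holomorphic_fun_def
proof (intro conjI ballI)
  show "open U" using assms by (simp add: holomorphic_fun_def)
  fix x assume "x \<in> U"
  then have "\<exists>D. (g has_derivative D) (at x) \<and> Vector_Spaces.linear (*s) (*) D"
    "\<exists>D. (h has_derivative D) (at x) \<and> Vector_Spaces.linear (*s) (*) D"
    using assms by (simp_all add: holomorphic_fun_def)
  then obtain D E where D: "(g has_derivative D) (at x)" "Vector_Spaces.linear (*s) (*) D"
    and E: "(h has_derivative E) (at x)" "Vector_Spaces.linear (*s) (*) E"
    by (elim exE conjE)
  have "Vector_Spaces.linear (*s) (*) (\<lambda>v. D v - E v)"
    using D(2) E(2) by (simp add: Vector_Spaces.linear_iff ring_distribs)
  with has_derivative_diff[OF D(1) E(1)]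
  show "\<exists>D. ((\<lambda>x. g x - h x) has_derivative D) (at x) \<and> Vector_Spaces.linear (*s) (*) D"
    by (intro exI conjI)
qed

text \<open>This is the shape of a component of \<open>kernel_part\<close>.\<close>

lemma holomorphic_fun_minus_sum:
  assumes "finite J" "holomorphic_fun U g" "\<And>j. j \<in> J \<Longrightarrow> holomorphic_fun U (h j)"
  shows "holomorphic_fun U (\<lambda>x. g x - (\<Sum>j\<in>J. h j x))"
  using assms(1,3)
proof (induction J rule: finite_induct)
  case empty
  then show ?case using assms(2) by simp
next
  case (insert j J)
  have "holomorphic_fun U (\<lambda>x. g x - (\<Sum>j\<in>J. h j x))"
    by (rule insert.IH) (rule insert.prems, simp)
  moreover have "holomorphic_fun U (h j)" by (rule insert.prems) simp
  ultimately have "holomorphic_fun U (\<lambda>x. (g x - (\<Sum>j\<in>J. h j x)) - h j x)"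
    by (rule holomorphic_fun_diff)
  then show ?case by (simp add: insert.hyps diff_diff_eq add.commute)
qed

section \<open>Foliations in a chart\<close>

lemma twisted_form_transition:
  "twisted_form_on q M F \<Longrightarrow> x \<in> tf_chart F a \<Longrightarrow> x \<in> tf_chart F b \<Longrightarrow>
     tf_form F a x v = tf_cocycle F a b x * tf_form F b x v"
  unfolding twisted_form_on_def by blast

text \<open>If the form of one chart is nonzero on \<open>v\<close>, the transition formula makes
  the form of every other chart at the point nonzero on the same \<open>v\<close>.\<close>

lemma regular_points_iff:
  assumes F: "twisted_form_on q M F" and a: "x \<in> tf_chart F a"
  shows "x \<in> regular_points F \<longleftrightarrow> (\<exists>v. tf_form F a x v \<noteq> 0)"
proof
  assume "x \<in> regular_points F"
  then show "\<exists>v. tf_form F a x v \<noteq> 0"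
    using a unfolding regular_points_def sing_set_def by blast
next
  assume "\<exists>v. tf_form F a x v \<noteq> 0"
  then obtain v where v: "tf_form F a x v \<noteq> 0" by blast
  have "tf_form F b x v \<noteq> 0" if "x \<in> tf_chart F b" for b
    using twisted_form_transition[OF F a that, of v] v by auto
  then show "x \<in> regular_points F"
    using a unfolding regular_points_def sing_set_def by blast
qed

lemma tangent_space_eq:
  assumes F: "twisted_form_on q M F" and a: "x \<in> tf_chart F a"
  shows "tangent_space F x = contraction_kernel (tf_form F a x)"
proof -
  have "tf_form F b x v = 0" if "x \<in> tf_chart F b" "tf_form F a x v = 0" for b v
    using twisted_form_transition[OF F that(1) a, of v] that(2) by simp
  then show ?thesis using a unfolding tangent_space_def contraction_kernel_def by blast
qed

lemma regular_point_chart: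
  assumes "x \<in> regular_points F"
  obtains a where "x \<in> tf_chart F a"
  using assms by (auto simp: regular_points_def)

lemma twisted_form_alternating:
  "twisted_form_on q M F \<Longrightarrow> x \<in> tf_chart F a \<Longrightarrow> alternating_form q (tf_form F a x)"
  unfolding twisted_form_on_def holomorphic_form_def by blast

lemma twisted_form_holomorphic:
  "twisted_form_on q M F \<Longrightarrow> holomorphic_fun (tf_chart F a) (\<lambda>x. tf_form F a x v)"
  unfolding twisted_form_on_def holomorphic_form_def by blast

lemma regular_points_subset: "twisted_form_on q M F \<Longrightarrow> regular_points F \<subseteq> M"
  unfolding twisted_form_on_def line_bundle_on_def regular_points_def by blast

lemma integrable_form_decomposable:
  assumes "integrable_form q F" "x \<in> regular_points F" "x \<in> tf_chart F a"
  obtains \<alpha> where "\<And>i. i < q \<Longrightarrow> Vector_Spaces.linear (*s) (*) (\<alpha> i)"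
    "tf_form F a x = wedge_one_forms q \<alpha>"
proof -
  have "x \<in> tf_chart F a - sing_set F" using assms by (simp add: regular_points_def)
  from assms(1)[unfolded integrable_form_def, rule_format, OF this]
  obtain V \<alpha> where V: "x \<in> V" "\<forall>i<q. holomorphic_one_form V (\<alpha> i)"
    "\<forall>y\<in>V. tf_form F a y = wedge_one_forms q (\<lambda>i. \<alpha> i y)"
    by (elim exE conjE)
  show thesis
  proof (rule that[of "\<lambda>i. \<alpha> i x"])
    show "Vector_Spaces.linear (*s) (*) (\<alpha> i x)" if "i < q" for i
      using V(1,2) that unfolding holomorphic_one_form_def by blast
    show "tf_form F a x = wedge_one_forms q (\<lambda>i. \<alpha> i x)" using V(1,3) by blast
  qed
qed

lemma
  fixes F :: "('i, 'n::finite) twisted_form"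
  assumes F: "foliation_on k M F" and x: "x \<in> regular_points F"
  shows dim_tangent_space: "vec.dim (tangent_space F x) = k"
    and subspace_tangent_space: "vec.subspace (tangent_space F x)"
proof -
  let ?q = "CARD('n) - k"
  have tw: "twisted_form_on ?q M F" and int: "integrable_form ?q F" and q: "0 < ?q" "k \<le> CARD('n)"
    using F by (auto simp: foliation_on_def)
  obtain a where a: "x \<in> tf_chart F a" using regular_point_chart[OF x] by blast
  obtain \<alpha> where \<alpha>: "\<And>i. i < ?q \<Longrightarrow> Vector_Spaces.linear (*s) (*) (\<alpha> i)"
    "tf_form F a x = wedge_one_forms ?q \<alpha>"
    by (rule integrable_form_decomposable[OF int x a]) blast
  obtain v where v: "tf_form F a x v \<noteq> 0" using regular_points_iff[OF tw a] x by blast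
  show "vec.dim (tangent_space F x) = k"
    unfolding tangent_space_eq[OF tw a]
    using dim_contraction_kernel[OF twisted_form_alternating[OF tw a] \<alpha>(2) q(1) \<alpha>(1) v] q by simp
  show "vec.subspace (tangent_space F x)"
    unfolding tangent_space_eq[OF tw a]
    by (rule subspace_contraction_kernel[OF twisted_form_alternating[OF tw a] q(1)])
qed

text \<open>
  By Cramer's rule \<open>kernel_part\<close> extends a tangent vector to a holomorphic tangent field, so only
  the existence theorem for ordinary differential equations is needed here, not Frobenius' theorem.
\<close>

lemma tangent_curve:
  fixes F :: "('i, 'n::finite) twisted_form"
  assumes F: "foliation_on k M F" and x: "x \<in> regular_points F" and u: "u \<in> tangent_space F x"
  obtains \<gamma> Y c where "\<gamma> 0 = x" "Y 0 = c *s u" "c \<noteq> 0" "continuous_on {0..1} Y"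
    "\<forall>t\<in>{0..1}. \<gamma> t \<in> regular_points F"
    "\<forall>t\<in>{0..1}. Y t \<in> tangent_space F (\<gamma> t)"
    "\<forall>t\<in>{0..1}. (\<gamma> has_vector_derivative Y t) (at t within {0..1})"
proof -
  let ?q = "CARD('n) - k"
  have tw: "twisted_form_on ?q M F" and int: "integrable_form ?q F" and q: "0 < ?q"
    using F by (auto simp: foliation_on_def)
  obtain a where a: "x \<in> tf_chart F a" using regular_point_chart[OF x] by blast
  let ?\<phi> = "tf_form F a"
  obtain v where v: "?\<phi> x v \<noteq> 0" using regular_points_iff[OF tw a] x by blast
  define X where "X y = kernel_part ?q (?\<phi> y) v u" for y
  note hol = twisted_form_holomorphic[OF tw, of a]
  have open_chart: "open (tf_chart F a)" using hol by (simp add: holomorphic_fun_def)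
  \<comment> \<open>With \<open>v\<close> fixed, the same \<open>v\<close> shows every point of
    \<open>U\<close> to be regular. A curve confined to a ball inside \<open>U\<close> then never
    meets the singular set.\<close>
  define U where "U = tf_chart F a \<inter> (\<lambda>y. ?\<phi> y v) -` (- {0})"
  have "continuous_on (tf_chart F a) (\<lambda>y. ?\<phi> y v)"
    by (intro continuous_at_imp_continuous_on ballI holomorphic_fun_continuous[OF hol])
  then have open_U: "open U"
    unfolding U_def by (rule continuous_open_preimage[OF _ open_chart]) auto
  have hol_U: "holomorphic_fun U (\<lambda>y. ?\<phi> y w)" for w
    by (rule holomorphic_fun_subset[OF hol open_U]) (simp add: U_def)
  have X: "holomorphic_map U X"
    unfolding holomorphic_map_def X_def kernel_part_def
    by (simp, intro allI holomorphic_fun_minus_sum holomorphic_fun_mult_right hol_U) simp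
  have U: "y \<in> regular_points F" "X y \<in> tangent_space F y" if "y \<in> U" for y
  proof -
    have y: "y \<in> tf_chart F a" "?\<phi> y v \<noteq> 0" using that by (auto simp: U_def)
    then show reg: "y \<in> regular_points F" using regular_points_iff[OF tw y(1)] by blast
    obtain \<alpha> where \<alpha>: "\<And>i. i < ?q \<Longrightarrow> Vector_Spaces.linear (*s) (*) (\<alpha> i)"
      "tf_form F a y = wedge_one_forms ?q \<alpha>"
      by (rule integrable_form_decomposable[OF int reg y(1)]) blast
    show "X y \<in> tangent_space F y"
      unfolding tangent_space_eq[OF tw y(1)] X_def \<alpha>(2) by (rule kernel_part_in_kernel[OF q \<alpha>(1)])
  qed
  have xU: "x \<in> U" using a v by (simp add: U_def)
  have "u \<in> contraction_kernel (?\<phi> x)" using u by (simp add: tangent_space_eq[OF tw a])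
  \<comment> \<open>As \<open>u\<close> already lies in the kernel, every correction term of
    \<open>kernel_part\<close> vanishes, so the field starts at a nonzero multiple of
    \<open>u\<close>.\<close>
  then have Xx: "X x = ?\<phi> x v *s u"
    using contraction_kernel_any_slot[OF twisted_form_alternating[OF tw a]]
    by (simp add: X_def kernel_part_def)
  obtain r C where r: "r > 0" "C \<ge> 0" "cball x r \<subseteq> U"
    and lip: "\<And>y z. y \<in> cball x r \<Longrightarrow> z \<in> cball x r \<Longrightarrow> norm (X y - X z) \<le> C * norm (y - z)"
    by (rule holomorphic_map_locally_lipschitz[OF X xU]) blast
  obtain \<gamma> \<delta> where \<gamma>: "\<delta> > 0" "\<gamma> 0 = x" "\<forall>t\<in>{0..1}. \<gamma> t \<in> cball x r"
    "\<forall>t\<in>{0..1}. (\<gamma> has_vector_derivative \<delta> *\<^sub>R X (\<gamma> t)) (at t within {0..1})"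
    by (rule picard_local_existence[OF r(1,2) lip]) blast
  have scale: "\<delta> *\<^sub>R w = complex_of_real \<delta> *s w" for w :: "complex ^ 'n"
    by (simp add: vec_eq_iff scaleR_conv_of_real[where 'a = complex])
  have \<gamma>U: "\<gamma> t \<in> U" if "t \<in> {0..1}" for t using \<gamma>(3)[rule_format, OF that] r(3) by blast
  show thesis
  proof (rule that[of \<gamma> "\<lambda>t. \<delta> *\<^sub>R X (\<gamma> t)" "complex_of_real \<delta> * ?\<phi> x v"])
    show "\<gamma> 0 = x" by fact
    show "\<delta> *\<^sub>R X (\<gamma> 0) = (complex_of_real \<delta> * ?\<phi> x v) *s u" by (simp add: \<gamma>(2) Xx scale)
    show "complex_of_real \<delta> * ?\<phi> x v \<noteq> 0" using \<gamma>(1) v by simp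
    have "continuous_on (cball x r) X"
      using r(2) lip by (intro lipschitz_on_continuous_on[of C] lipschitz_onI) (auto simp: dist_norm)
    moreover have "continuous_on {0..1} \<gamma>"
      unfolding continuous_on_eq_continuous_within
      by (intro ballI has_vector_derivative_continuous[OF \<gamma>(4)[rule_format]])
    ultimately have "continuous_on {0..1} (\<lambda>t. X (\<gamma> t))"
      by (rule continuous_on_compose2) (use \<gamma>(3) in blast)
    then show "continuous_on {0..1} (\<lambda>t. \<delta> *\<^sub>R X (\<gamma> t))" by (intro continuous_intros)
    show "\<forall>t\<in>{0..1}. \<gamma> t \<in> regular_points F" by (intro ballI U(1) \<gamma>U)
    show "\<forall>t\<in>{0..1}. \<delta> *\<^sub>R X (\<gamma> t) \<in> tangent_space F (\<gamma> t)"
      unfolding scale by (intro ballI vec.subspace_scale[OF subspace_tangent_space[OF F]] U \<gamma>U)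
  qed (fact \<gamma>(4))
qed

text \<open>\<open>leaf\<close> asks for a path on the unit interval, so the arc of
  \<open>\<gamma>\<close> up to time \<open>T\<close> is traversed at \<open>T\<close> times the
  speed. For \<open>T = 0\<close> this is the constant path, whose velocity 0 is tangent as
  well.\<close>

lemma tangent_curve_in_leaf:
  fixes F :: "('i, 'n::finite) twisted_form"
  assumes F: "foliation_on k M F" and Y: "continuous_on {0..1} Y"
    and reg: "\<And>t. t \<in> {0..1} \<Longrightarrow> \<gamma> t \<in> regular_points F"
    and tan: "\<And>t. t \<in> {0..1} \<Longrightarrow> Y t \<in> tangent_space F (\<gamma> t)"
    and der: "\<And>t. t \<in> {0..1} \<Longrightarrow> (\<gamma> has_vector_derivative Y t) (at t within {0..1})"
    and T: "T \<in> {0..1::real}"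
  shows "\<gamma> T \<in> leaf F (\<gamma> 0)"
proof -
  define p where "p s = \<gamma> (T * s)" for s
  have Ts: "T * s \<in> {0..1}" if "s \<in> {0..1}" for s using that T by (auto intro: mult_le_one)
  have dp: "(p has_vector_derivative T *\<^sub>R Y (T * s)) (at s within {0..1})" if s: "s \<in> {0..1}" for s
  proof -
    have "((\<lambda>s. T * s) has_vector_derivative T) (at s within {0..1})"
      by (auto intro!: derivative_eq_intros)
    moreover have "(\<gamma> has_vector_derivative Y (T * s)) (at (T * s) within (\<lambda>s. T * s) ` {0..1})"
      by (rule has_vector_derivative_within_subset[OF der[OF Ts[OF s]]]) (use Ts in auto)
    ultimately have "(\<gamma> \<circ> (\<lambda>s. T * s) has_vector_derivative T *\<^sub>R Y (T * s)) (at s within {0..1})"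
      by (rule vector_diff_chain_within)
    then show ?thesis by (simp add: p_def [abs_def] comp_def)
  qed
  have contp: "continuous_on {0..1} p"
    unfolding continuous_on_eq_continuous_within
    by (intro ballI has_vector_derivative_continuous[OF dp])
  \<comment> \<open>\<open>leaf\<close> and C1 paths use two-sided derivatives, whereas
    \<open>\<gamma>\<close> has only one-sided ones at the ends; hence 0 and 1 form the exceptional
    set.\<close>
  have inner: "(p has_vector_derivative T *\<^sub>R Y (T * s)) (at s)" if "s \<in> {0..1} - {0, 1}" for s
  proof -
    have "at s within {0..1} = at s" using that by (intro at_within_Icc_at) auto
    then show ?thesis using dp[of s] that by simp
  qed
  have contY: "continuous_on ({0..1} - {0, 1}) (\<lambda>s. T *\<^sub>R Y (T * s))"
    by (intro continuous_on_scaleR continuous_on_const continuous_on_compose2[OF Y] continuous_intros)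
      (use Ts in auto)
  have "p C1_differentiable_on ({0..1} - {0, 1})"
    unfolding C1_differentiable_on_def
    by (intro exI[of _ "\<lambda>s. T *\<^sub>R Y (T * s)"] conjI ballI inner contY)
  then have "valid_path p"
    unfolding valid_path_def piecewise_C1_differentiable_on_def
    by (intro conjI contp exI[of _ "{0, 1}"]) auto
  moreover have "T *\<^sub>R Y (T * s) \<in> tangent_space F (p s)" if "s \<in> {0..1}" for s
  proof -
    have "T *\<^sub>R Y (T * s) = complex_of_real T *s Y (T * s)"
      by (simp add: vec_eq_iff scaleR_conv_of_real[where 'a = complex])
    also have "\<dots> \<in> tangent_space F (\<gamma> (T * s))"
      by (intro vec.subspace_scale[OF subspace_tangent_space[OF F reg]] tan Ts that)
    finally show ?thesis by (simp add: p_def)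
  qed
  then have "\<exists>S. finite S \<and> (\<forall>s\<in>{0..1} - S. \<exists>u\<in>tangent_space F (p s). (p has_vector_derivative u) (at s))"
    using inner by (intro exI[of _ "{0, 1}"]) blast
  moreover have "path_image p \<subseteq> regular_points F"
    using reg Ts by (auto simp: path_image_def p_def)
  ultimately show ?thesis
    unfolding leaf_def by (intro CollectI exI[of _ p]) (simp add: pathstart_def pathfinish_def p_def)
qed

lemma tangent_space_log_hessian_kernel:
  fixes F :: "('i, 'n::finite) twisted_form"
  assumes F: "is_polar_foliation f F" and x: "x \<in> regular_points F" and u: "u \<in> tangent_space F x"
    and torus: "x \<in> torus"
  shows "log_hessian_map f x (torus_inverse x * u) = 0"
proof -
  have fol: "foliation_on (polar_fiber_dim f) torus F" and const: "log_polar f constant_on leaf F x"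
    using F x by (auto simp: is_polar_foliation_def)
  obtain \<gamma> Y c where \<gamma>: "\<gamma> 0 = x" "Y 0 = c *s u" "c \<noteq> 0" "continuous_on {0..1} Y"
    "\<forall>t\<in>{0..1}. \<gamma> t \<in> regular_points F"
    "\<forall>t\<in>{0..1}. Y t \<in> tangent_space F (\<gamma> t)"
    "\<forall>t\<in>{0..1}. (\<gamma> has_vector_derivative Y t) (at t within {0..1})"
    by (rule tangent_curve[OF fol x u]) blast
  let ?D = "\<lambda>h. log_hessian_map f x (torus_inverse x * h)"
  have leaf: "\<gamma> t \<in> leaf F x" if "t \<in> {0..1}" for t
    using tangent_curve_in_leaf[OF fol \<gamma>(4) \<gamma>(5-7)[rule_format] that] \<gamma>(1) by simp
  obtain z where z: "\<And>p. p \<in> leaf F x \<Longrightarrow> log_polar f p = z"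
    using const by (auto simp: constant_on_def)
  have "(log_polar f has_derivative ?D) (at (\<gamma> 0) within \<gamma> ` {0..1})"
    unfolding \<gamma>(1) by (rule has_derivative_at_withinI[OF has_derivative_log_polar[OF torus]])
  then have "(log_polar f \<circ> \<gamma> has_vector_derivative ?D (Y 0)) (at 0 within {0..1})"
    by (intro vector_derivative_diff_chain_within \<gamma>(7)[rule_format]) auto
  moreover have "(log_polar f \<circ> \<gamma> has_vector_derivative 0) (at 0 within {0..1})"
    by (rule has_vector_derivative_transform[OF _ _ has_vector_derivative_const[of z]])
      (auto simp: z leaf)
  \<comment> \<open>Both derivatives at 0 are one-sided, and such a derivative is unique on an
    interval of positive length. Complex linearity then removes the factor \<open>c\<close> from
    \<open>Y 0\<close>.\<close>
  ultimately have "?D (Y 0) = 0"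
    using vector_derivative_unique_within_closed_interval[of 0 1 0 "log_polar f \<circ> \<gamma>" "?D (Y 0)" 0]
    by auto
  moreover have "?D (c *s u) = c *s ?D u"
    using linear_log_hessian_map[of f x "torus_inverse x"] by (simp add: Vector_Spaces.linear_iff)
  ultimately show ?thesis using \<gamma>(2,3) by simp
qed

lemma torus_inverse_mult:
  assumes "x \<in> torus"
  shows "torus_inverse x * (x * u) = u" "x * (torus_inverse x * u) = u"
  using assms by (auto simp: torus_def torus_inverse_def vec_eq_iff)

text \<open>Where the rank drops, inclusion in the Hessian kernel is too weak, so the opposite
  inclusion is proved. If \<open>x * w\<close> were not tangent at \<open>x\<close>, then
  \<open>y * w\<close> would fail to be tangent for all \<open>y\<close> near \<open>x\<close>,
  among them a generic one. Equality of dimensions does the rest.\<close>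

lemma tangent_space_polar_foliation:
  fixes F :: "('i, 'n::finite) twisted_form"
  assumes F: "is_polar_foliation f F" and x: "x \<in> regular_points F"
  shows "tangent_space F x = {u. torus_inverse x * u \<in> annihilator f}"
proof -
  let ?k = "polar_fiber_dim f" and ?A = "\<lambda>y. {u. torus_inverse y * u \<in> annihilator f}"
  have fol: "foliation_on ?k torus F" using F by (simp add: is_polar_foliation_def)
  let ?q = "CARD('n) - ?k"
  have tw: "twisted_form_on ?q torus F" and q: "0 < ?q"
    using fol by (auto simp: foliation_on_def)
  have torus: "y \<in> torus" if "y \<in> regular_points F" for y
    using regular_points_subset[OF tw] that by blast
  have sub: "vec.subspace (?A y)" for y
  proof -
    have "torus_inverse y * (u + w) = torus_inverse y * u + torus_inverse y * w"
      "torus_inverse y * (c *s u) = c *s (torus_inverse y * u)" for u w c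
      by (simp_all add: vec_eq_iff algebra_simps)
    then show ?thesis
      using subspace_annihilator[of f] by (auto simp: vec.subspace_def)
  qed
  have dim: "vec.dim (tangent_space F y) = vec.dim (?A y)" if "y \<in> regular_points F" for y
    using dim_tangent_space[OF fol that] dim_torus_translate[OF torus[OF that], of "annihilator f"]
    by (simp add: polar_fiber_dim_eq)
  have generic: "tangent_space F y = ?A y"
    if y: "y \<in> regular_points F" and ker: "\<And>w. log_hessian_map f y w = 0 \<Longrightarrow> w \<in> annihilator f" for y
  proof (rule vec.subspace_dim_equal[OF subspace_tangent_space[OF fol y] sub])
    show "tangent_space F y \<subseteq> ?A y"
      using tangent_space_log_hessian_kernel[OF F y _ torus[OF y]] ker by blast
  qed (simp add: dim[OF y])
  have "?A x \<subseteq> tangent_space F x"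
  proof
    fix u assume "u \<in> ?A x"
    define w where "w = torus_inverse x * u"
    have w: "w \<in> annihilator f" using \<open>u \<in> ?A x\<close> by (simp add: w_def)
    have u: "u = x * w" by (simp add: w_def torus_inverse_mult[OF torus[OF x]])
    obtain a where a: "x \<in> tf_chart F a" using regular_point_chart[OF x] by blast
    let ?\<phi> = "tf_form F a"
    note hol = twisted_form_holomorphic[OF tw, of a]
    show "u \<in> tangent_space F x"
    proof (rule ccontr)
      assume "u \<notin> tangent_space F x"
      then obtain v where v: "?\<phi> x (v(0 := x * w)) \<noteq> 0"
        by (auto simp: tangent_space_eq[OF tw a] contraction_kernel_def u)
      \<comment> \<open>\<open>holomorphic_form\<close> gives continuity in the point only for fixed
        argument vectors, but \<open>y * w\<close> moves with \<open>y\<close>. Expansion in the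
        standard basis confines the motion to scalar coefficients.\<close>
      define h where "h y = (\<Sum>i\<in>UNIV. (y $ i * w $ i) * ?\<phi> y (v(0 := axis i 1)))" for y
      have h: "h y = ?\<phi> y (v(0 := y * w))" if "y \<in> tf_chart F a" for y
      proof -
        have "y * w = (\<Sum>i\<in>UNIV. (y $ i * w $ i) *s axis i 1)"
          using basis_expansion[of "y * w"] by simp
        then show ?thesis
          by (simp add: h_def linear_functional_simps[OF alternating_form_linear[OF twisted_form_alternating[OF tw that] q]])
      qed
      have open_chart: "open (tf_chart F a)" using hol by (simp add: holomorphic_fun_def)
      have "continuous_on (tf_chart F a) (\<lambda>y. ?\<phi> y z)" for z
        by (intro continuous_at_imp_continuous_on ballI holomorphic_fun_continuous[OF hol])
      then have "continuous_on (tf_chart F a) h"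
        unfolding h_def by (intro continuous_intros)
      then have "open (tf_chart F a \<inter> h -` (- {0}))"
        by (rule continuous_open_preimage[OF _ open_chart]) auto
      moreover have "x \<in> tf_chart F a \<inter> h -` (- {0})" using a v h by simp
      ultimately obtain y where y: "y \<in> tf_chart F a \<inter> h -` (- {0})" "y \<in> torus"
        and ker: "\<And>w. log_hessian_map f y w = 0 \<Longrightarrow> w \<in> annihilator f"
        by (rule generic_points_dense[OF torus[OF x]]) blast
      have ya: "y \<in> tf_chart F a" and nz: "?\<phi> y (v(0 := y * w)) \<noteq> 0" using y(1) h by auto
      then have reg: "y \<in> regular_points F" using regular_points_iff[OF tw ya] by blast
      have "y * w \<in> ?A y" using w by (simp add: torus_inverse_mult[OF y(2)])
      then have "y * w \<in> contraction_kernel (?\<phi> y)"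
        using generic[OF reg ker] tangent_space_eq[OF tw ya] by simp
      then show False using nz by (simp add: contraction_kernel_def)
    qed
  qed
  then have "?A x = tangent_space F x"
    by (rule vec.subspace_dim_equal[OF sub subspace_tangent_space[OF fol x]]) (simp add: dim[OF x])
  then show ?thesis by simp
qed

section \<open>Translation to the Lie algebra\<close>

lemma log_gauss_map_eq: "log_gauss_map F x = (\<lambda>u. torus_inverse x * u) ` tangent_space F x"
proof -
  have "linear (\<lambda>u :: complex ^ 'a. torus_inverse x * u)"
    by (rule linearI) (simp_all add: vec_eq_iff algebra_simps)
  then have "(translation (torus_inverse x) has_derivative (\<lambda>u. torus_inverse x * u)) (at x)"
    unfolding translation_def [abs_def]
    by (intro bounded_linear_imp_has_derivative) (simp add: linear_conv_bounded_linear)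
  then have "frechet_derivative (translation (torus_inverse x)) (at x) = (\<lambda>u. torus_inverse x * u)"
    by (rule frechet_derivative_at[symmetric])
  then show ?thesis by (simp add: log_gauss_map_def)
qed

theorem proposition2:
  fixes f :: "'n::finite laurent" and F :: "('i, 'n) twisted_form"
  assumes "det (log_hessian f) = 0"
    and "polar_fiber_dim f < CARD('n) \<Longrightarrow> is_polar_foliation f F"
  shows "\<exists>W\<in>grassmannian (polar_fiber_dim f).
           \<forall>x\<in>polar_gauss_domain f F. polar_gauss_map f F x = W"
proof (cases "polar_fiber_dim f = CARD('n)")
  case True
  then have "(UNIV :: (complex ^ 'n) set) \<in> grassmannian (polar_fiber_dim f)"
    unfolding grassmannian_def
    by (simp only: mem_Collect_eq vec_dim_card vec.subspace_UNIV simp_thms)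
  then show ?thesis using True by (auto simp: polar_gauss_map_def)
next
  case False
  \<comment> \<open>Natural subtraction bounds \<open>polar_fiber_dim f\<close> by the dimension, so
    being different means being smaller.\<close>
  then have F: "is_polar_foliation f F" by (intro assms(2)) (simp add: polar_fiber_dim_def)
  have "polar_gauss_map f F x = annihilator f" if "x \<in> polar_gauss_domain f F" for x
  proof -
    have x: "x \<in> regular_points F" using that False by (simp add: polar_gauss_domain_def)
    then have "x \<in> torus"
      using F regular_points_subset unfolding is_polar_foliation_def foliation_on_def by blast
    then have "w \<in> (\<lambda>u. torus_inverse x * u) ` {u. torus_inverse x * u \<in> annihilator f}"
      if "w \<in> annihilator f" for w
      using that by (intro image_eqI[of _ _ "x * w"]) (simp_all add: torus_inverse_mult)
    then have "(\<lambda>u. torus_inverse x * u) ` {u. torus_inverse x * u \<in> annihilator f} = annihilator f"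
      by blast
    then show ?thesis
      using False by (simp add: polar_gauss_map_def log_gauss_map_eq tangent_space_polar_foliation[OF F x])
  qed
  moreover have "annihilator f \<in> grassmannian (polar_fiber_dim f)"
    by (simp add: grassmannian_def subspace_annihilator polar_fiber_dim_eq)
  ultimately show ?thesis by blast
qed

end
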